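(* Let $M$ be a finite-dimensional smooth manifold and let $\frac{d}{dt}x(t)=F(t,x(t),u(t))$ be a control system evolving on $M$. Then, for any choice of the control input $u$, the associated Koopman operator $U_t:C^\infty(M)\rightarrow C^\infty(M)$ satisfies the following: (1) For each $t\in\mathbb{R}$, $U_t$ is continuous in the $C^\infty$-topology on $C^\infty(M)$. (2) The family $\{U_t\}_{t\in\mathbb{R}}$ is a strongly continuous one-parameter subgroup of $\mathrm{Aut}(C^\infty(M))$. (3) $U_t$ satisfies the differential equation system on $\mathrm{Aut}(C^\infty(M))$ given by $$\frac{d}{dt}U_t=\mathcal{L}_FU_t=U_t\mathcal{L}_F$$ with the initial condition $U_0=I$, the identity of the group $\mathrm{Aut}(C^\infty(M))$.
   Context: The control input $u$ takes values in $\mathbb{R}^m$, and for any given control input $u$, $F$ is a time-dependent smooth vector field on $M$. The starting time of the system is always set to be $0$, and $u$ is treated as an intermediate variable (a parameter). For any choice of the control input, the vector field $F$ is assumed to be complete, so that the system generates a global flow $\Phi:\mathbb{R}\times M\rightarrow M$, where $\Phi(t,x)$ is the state at time $t$ of the system starting from $x$ at time $0$; write $\Phi_t=\Phi(t,\cdot)$. Koopman operator: $U_t h=h\circ\Phi_t$ for $h\in C^\infty(M)$ (the real-valued smooth functions on $M$, called observables); it depends on the control input through $\Phi_t$. The family $\{U_t\}_{t\in\mathbb{R}}$ is called the Koopman group. The $C^\infty$-topology on $C^\infty(M)$ is generated by the seminorms $\|h\|_{i,j}=\sup_{x\in\overline{V}_i}|D^jh(x)|$, $i,j\in\mathbb{N}$,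 where $\{V_i\}$ is an increasing open cover of $M$ by precompact open sets with $\overline{V}_i\subset V_{i+1}$, and $D^j:C^\infty(M)\to C^\infty(\otimes^jT^*M)$ is the $j$-th iterated covariant derivative (e.g. for a Levi-Civita connection); the topology does not depend on these choices. $\mathrm{Aut}(C^\infty(M))$ is the group of invertible bounded (i.e. continuous) linear operators from $C^\infty(M)$ to itself under composition. Strong continuity means $U_th\to h$ in the $C^\infty$-topology as $t\to0$ for every $h\in C^\infty(M)$. $\mathcal{L}_F$ is the Lie derivative with respect to $F$, $\mathcal{L}_Fh=dh(F)$. The operator differential equation is understood in the strong operator topology, i.e. after applying both sides to an arbitrary $h\in C^\infty(M)$, with convergence in the $C^\infty$-topology.
   Formalization: The solution maps are assumed to form a smooth flow with the group law Φ_{s+t} = Φ_s∘Φ_t, which forces F(t,·,u(t)) not to depend on t; for general time-dependent F, e.g. dx/dt = t on the real line, part (2) fails. Also dim M ≥ 1. *)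

theory Defs
  imports "HOL-Analysis.Analysis" "HOL-Algebra.Group"
begin

section \<open>Smooth manifolds and smooth functions\<close>

text \<open>\<open>C\<^sup>k\<close> and \<open>C\<^sup>\<infinity>\<close> maps on an open subset \<open>S\<close> of a Euclidean space.\<close>

primrec Ck_on :: "nat \<Rightarrow> 'e::euclidean_space set \<Rightarrow> ('e \<Rightarrow> 'b::real_normed_vector) \<Rightarrow> bool" where
  "Ck_on 0 S f \<longleftrightarrow> continuous_on S f"
| "Ck_on (Suc k) S f \<longleftrightarrow> (\<forall>x\<in>S. f differentiable (at x)) \<and>
     (\<forall>v. Ck_on k S (\<lambda>x. frechet_derivative f (at x) v))"

definition smooth_on :: "'e::euclidean_space set \<Rightarrow> ('e \<Rightarrow> 'b::real_normed_vector) \<Rightarrow> bool" where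
  "smooth_on S f \<longleftrightarrow> (\<forall>k. Ck_on k S f)"

text \<open>
  The points of a manifold are the elements of a Hausdorff, second countable type; its smooth
  structure is given by an atlas (not necessarily maximal), a chart being a pair \<open>(U, \<phi>)\<close> of its
  domain and its coordinate map.
\<close>

type_synonym ('a, 'e) atlas = "('a set \<times> ('a \<Rightarrow> 'e)) set"

definition smooth_manifold ::
    "('a::{t2_space,second_countable_topology}, 'e::euclidean_space) atlas \<Rightarrow> bool" where
  "smooth_manifold A \<longleftrightarrow>
     (\<Union>(U, \<phi>)\<in>A. U) = UNIV \<and>
     (\<forall>(U, \<phi>)\<in>A. open U \<and> open (\<phi> ` U) \<and> homeomorphism U (\<phi> ` U) \<phi> (inv_into U \<phi>)) \<and>
     (\<forall>(U, \<phi>)\<in>A. \<forall>(V, \<psi>)\<in>A. smooth_on (\<phi> ` (U \<inter> V)) (\<psi> \<circ> inv_into U \<phi>))"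

definition Cinf :: "('a::topological_space, 'e::euclidean_space) atlas \<Rightarrow> ('a \<Rightarrow> real) set" where
  "Cinf A = {h. \<forall>(U, \<phi>)\<in>A. smooth_on (\<phi> ` U) (h \<circ> inv_into U \<phi>)}"

definition smooth_map ::
    "('a::topological_space, 'e::euclidean_space) atlas \<Rightarrow>
     ('b::topological_space, 'f::euclidean_space) atlas \<Rightarrow> ('a \<Rightarrow> 'b) \<Rightarrow> bool" where
  "smooth_map A B f \<longleftrightarrow> continuous_on UNIV f \<and>
     (\<forall>(U, \<phi>)\<in>A. \<forall>(V, \<psi>)\<in>B. smooth_on (\<phi> ` (U \<inter> f -` V)) (\<psi> \<circ> f \<circ> inv_into U \<phi>))"

text \<open>The product manifold \<open>\<real> \<times> M\<close>.\<close>

definition time_atlas :: "('a, 'e::euclidean_space) atlas \<Rightarrow> (real \<times> 'a, real \<times> 'e) atlas" where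
  "time_atlas A = (\<lambda>(U, \<phi>). (UNIV \<times> U, \<lambda>(t, p). (t, \<phi> p))) ` A"

section \<open>Vector fields, connections and Riemannian metrics\<close>

text \<open>
  Tangent vectors at \<open>p\<close> are the derivations of \<open>C\<^sup>\<infinity>(M)\<close> at \<open>p\<close>. They are set to zero on functions
  that are not smooth, so that equality of tangent vectors is equality of HOL functions. With this
  model \<open>dh\<^sub>p(v) = v h\<close>.
\<close>

type_synonym 'a tvec = "('a \<Rightarrow> real) \<Rightarrow> real"
type_synonym 'a vfield = "'a \<Rightarrow> 'a tvec"

definition tangent_space ::
    "('a::topological_space, 'e::euclidean_space) atlas \<Rightarrow> 'a \<Rightarrow> 'a tvec set" where
  "tangent_space A p = {v.
     (\<forall>h\<in>Cinf A. \<forall>k\<in>Cinf A. \<forall>a b. v (\<lambda>x. a * h x + b * k x) = a * v h + b * v k) \<and>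
     (\<forall>h\<in>Cinf A. \<forall>k\<in>Cinf A. v (\<lambda>x. h x * k x) = h p * v k + k p * v h) \<and>
     (\<forall>h. h \<notin> Cinf A \<longrightarrow> v h = 0)}"

definition vector_fields ::
    "('a::topological_space, 'e::euclidean_space) atlas \<Rightarrow> 'a vfield set" where
  "vector_fields A = {X. (\<forall>p. X p \<in> tangent_space A p) \<and>
     (\<forall>h\<in>Cinf A. (\<lambda>p. X p h) \<in> Cinf A)}"

text \<open>Smoothness of a time-dependent vector field is joint smoothness in time and space.\<close>

definition time_dependent_vector_field ::
    "('a::topological_space, 'e::euclidean_space) atlas \<Rightarrow> (real \<Rightarrow> 'a vfield) \<Rightarrow> bool" where
  "time_dependent_vector_field A X \<longleftrightarrow> (\<forall>t p. X t p \<in> tangent_space A p) \<and>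
     (\<forall>h\<in>Cinf A. (\<lambda>(t, p). X t p h) \<in> Cinf (time_atlas A))"

definition lie_derivative ::
    "('a::topological_space, 'e::euclidean_space) atlas \<Rightarrow> 'a vfield \<Rightarrow>
     ('a \<Rightarrow> real) \<Rightarrow> ('a \<Rightarrow> real)" where
  "lie_derivative A X = (\<lambda>h\<in>Cinf A. \<lambda>p. X p h)"

text \<open>\<open>vf_comb f X k Y\<close> is the vector field \<open>f X + k Y\<close>.\<close>

definition vf_comb ::
    "('a \<Rightarrow> real) \<Rightarrow> 'a vfield \<Rightarrow> ('a \<Rightarrow> real) \<Rightarrow> 'a vfield \<Rightarrow> 'a vfield" where
  "vf_comb f X k Y = (\<lambda>p h. f p * X p h + k p * Y p h)"

definition affine_connection ::
    "('a::topological_space, 'e::euclidean_space) atlas \<Rightarrow>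
     ('a vfield \<Rightarrow> 'a vfield \<Rightarrow> 'a vfield) \<Rightarrow> bool" where
  "affine_connection A conn \<longleftrightarrow>
     (\<forall>X\<in>vector_fields A. \<forall>Y\<in>vector_fields A. conn X Y \<in> vector_fields A) \<and>
     (\<forall>X\<in>vector_fields A. \<forall>Y\<in>vector_fields A. \<forall>Z\<in>vector_fields A. \<forall>f\<in>Cinf A. \<forall>k\<in>Cinf A.
        conn (vf_comb f X k Y) Z = vf_comb f (conn X Z) k (conn Y Z)) \<and>
     (\<forall>X\<in>vector_fields A. \<forall>Y\<in>vector_fields A. \<forall>Z\<in>vector_fields A. \<forall>a b.
        conn X (vf_comb (\<lambda>_. a) Y (\<lambda>_. b) Z) = vf_comb (\<lambda>_. a) (conn X Y) (\<lambda>_. b) (conn X Z)) \<and>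
     (\<forall>X\<in>vector_fields A. \<forall>Y\<in>vector_fields A. \<forall>f\<in>Cinf A.
        conn X (\<lambda>p h. f p * Y p h) = vf_comb f (conn X Y) (\<lambda>p. X p f) Y)"

definition riemannian_metric ::
    "('a::topological_space, 'e::euclidean_space) atlas \<Rightarrow>
     ('a \<Rightarrow> 'a tvec \<Rightarrow> 'a tvec \<Rightarrow> real) \<Rightarrow> bool" where
  "riemannian_metric A g \<longleftrightarrow>
     (\<forall>p. \<forall>v\<in>tangent_space A p. \<forall>w\<in>tangent_space A p.
        g p v w = g p w v \<and>
        (\<forall>z\<in>tangent_space A p. \<forall>a b.
           g p (\<lambda>h. a * v h + b * w h) z = a * g p v z + b * g p w z)) \<and>
     (\<forall>p. \<forall>v\<in>tangent_space A p. v \<noteq> (\<lambda>h. 0) \<longrightarrow> g p v v > 0) \<and>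
     (\<forall>X\<in>vector_fields A. \<forall>Y\<in>vector_fields A. (\<lambda>p. g p (X p) (Y p)) \<in> Cinf A)"

section \<open>The \<open>C\<^sup>\<infinity>\<close>-topology\<close>

text \<open>
  \<open>cov_deriv conn h [X\<^sub>1, \<dots>, X\<^sub>j]\<close> is the function \<open>(D\<^sup>j h)(X\<^sub>1, \<dots>, X\<^sub>j)\<close>, where the covariant
  \<open>j\<close>-tensor field \<open>D\<^sup>j h\<close> is the iterated covariant derivative of \<open>h\<close>, with the most recent
  differentiation direction in the first slot:
  \<open>(D T)(X, X\<^sub>1, \<dots>) = X (T(X\<^sub>1, \<dots>)) - \<Sum>\<^sub>l T(X\<^sub>1, \<dots>, \<nabla>\<^sub>X X\<^sub>l, \<dots>)\<close>.
\<close>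

function cov_deriv ::
    "('a vfield \<Rightarrow> 'a vfield \<Rightarrow> 'a vfield) \<Rightarrow> ('a \<Rightarrow> real) \<Rightarrow> 'a vfield list \<Rightarrow> 'a \<Rightarrow> real" where
  "cov_deriv conn h [] = h"
| "cov_deriv conn h (X # Xs) = (\<lambda>p. X p (cov_deriv conn h Xs) -
     (\<Sum>l<length Xs. cov_deriv conn h (Xs[l := conn X (Xs ! l)]) p))"
  by pat_completeness auto
termination by (relation "Wellfounded.measure (\<lambda>(_, _, Xs). length Xs)") auto

text \<open>
  \<open>\<bar>D\<^sup>j h(p)\<bar>\<close>, in the operator norm on covariant \<open>j\<close>-tensors induced by the inner product \<open>g p\<close>.
  The arguments in \<open>T\<^sub>p M\<close> are given as values at \<open>p\<close> of vector fields; \<open>D\<^sup>j h\<close> being tensorial, the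
  choice of the fields does not matter.
\<close>

definition cov_deriv_norm ::
    "('a::topological_space, 'e::euclidean_space) atlas \<Rightarrow>
     ('a \<Rightarrow> 'a tvec \<Rightarrow> 'a tvec \<Rightarrow> real) \<Rightarrow> ('a vfield \<Rightarrow> 'a vfield \<Rightarrow> 'a vfield) \<Rightarrow>
     nat \<Rightarrow> ('a \<Rightarrow> real) \<Rightarrow> 'a \<Rightarrow> real" where
  "cov_deriv_norm A g conn j h p =
     Sup {\<bar>cov_deriv conn h Xs p\<bar> | Xs. length Xs = j \<and>
            (\<forall>X\<in>set Xs. X \<in> vector_fields A \<and> g p (X p) (X p) \<le> 1)}"

definition exhaustion :: "(nat \<Rightarrow> 'a::topological_space set) \<Rightarrow> bool" where
  "exhaustion V \<longleftrightarrow> (\<forall>i. open (V i) \<and> compact (closure (V i)) \<and> closure (V i) \<subseteq> V (Suc i)) \<and>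
     (\<Union>i. V i) = UNIV"

text \<open>The inserted \<open>0\<close> only matters when \<open>V i\<close> is empty.\<close>

definition cinf_seminorm ::
    "('a::topological_space, 'e::euclidean_space) atlas \<Rightarrow>
     ('a \<Rightarrow> 'a tvec \<Rightarrow> 'a tvec \<Rightarrow> real) \<Rightarrow> ('a vfield \<Rightarrow> 'a vfield \<Rightarrow> 'a vfield) \<Rightarrow>
     (nat \<Rightarrow> 'a set) \<Rightarrow> nat \<Rightarrow> nat \<Rightarrow> ('a \<Rightarrow> real) \<Rightarrow> real" where
  "cinf_seminorm A g conn V i j h = Sup (insert 0 (cov_deriv_norm A g conn j h ` closure (V i)))"

definition cinf_topology ::
    "('a::topological_space, 'e::euclidean_space) atlas \<Rightarrow>
     ('a \<Rightarrow> 'a tvec \<Rightarrow> 'a tvec \<Rightarrow> real) \<Rightarrow> ('a vfield \<Rightarrow> 'a vfield \<Rightarrow> 'a vfield) \<Rightarrow>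
     (nat \<Rightarrow> 'a set) \<Rightarrow> ('a \<Rightarrow> real) topology" where
  "cinf_topology A g conn V = topology_generated_by
     {{h \<in> Cinf A. cinf_seminorm A g conn V i j (\<lambda>x. h x - k x) < r} | i j k r.
        k \<in> Cinf A \<and> r > 0}"

section \<open>Operators on \<open>C\<^sup>\<infinity>(M)\<close>\<close>

text \<open>
  Operators on \<open>C\<^sup>\<infinity>(M)\<close> are functions that are \<open>undefined\<close> outside \<open>C\<^sup>\<infinity>(M)\<close>. Below, \<open>C\<close> is the set
  \<open>C\<^sup>\<infinity>(M)\<close> and \<open>\<T>\<close> its topology.
\<close>

definition Aut ::
    "('a \<Rightarrow> real) set \<Rightarrow> ('a \<Rightarrow> real) topology \<Rightarrow> (('a \<Rightarrow> real) \<Rightarrow> ('a \<Rightarrow> real)) monoid" where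
  "Aut C \<T> =
     \<lparr> carrier = {T \<in> extensional C. homeomorphic_map \<T> \<T> T \<and>
         (\<forall>h\<in>C. \<forall>k\<in>C. \<forall>a b. T (\<lambda>x. a * h x + b * k x) = (\<lambda>x. a * T h x + b * T k x))},
       mult = compose C,
       one = (\<lambda>h\<in>C. h) \<rparr>"

definition real_group :: "real monoid" where
  "real_group = \<lparr> carrier = UNIV, mult = (+), one = 0 \<rparr>"

definition strongly_continuous_one_parameter_subgroup ::
    "('a \<Rightarrow> real) set \<Rightarrow> ('a \<Rightarrow> real) topology \<Rightarrow>
     (real \<Rightarrow> ('a \<Rightarrow> real) \<Rightarrow> ('a \<Rightarrow> real)) \<Rightarrow> bool" where
  "strongly_continuous_one_parameter_subgroup C \<T> U \<longleftrightarrow>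
     U \<in> hom real_group (Aut C \<T>) \<and> (\<forall>h\<in>C. limitin \<T> (\<lambda>t. U t h) h (at 0))"

definition has_strong_derivative ::
    "('a \<Rightarrow> real) set \<Rightarrow> ('a \<Rightarrow> real) topology \<Rightarrow>
     (real \<Rightarrow> ('a \<Rightarrow> real) \<Rightarrow> ('a \<Rightarrow> real)) \<Rightarrow> (('a \<Rightarrow> real) \<Rightarrow> ('a \<Rightarrow> real)) \<Rightarrow> real \<Rightarrow> bool" where
  "has_strong_derivative C \<T> U T t \<longleftrightarrow>
     (\<forall>h\<in>C. limitin \<T> (\<lambda>s. \<lambda>x. (U (t + s) h x - U t h x) / s) (T h) (at 0))"

section \<open>Flows and Koopman operators\<close>

text \<open>
  A global flow is a smooth action of the additive group of the reals. It is generated by a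
  time-dependent vector field \<open>X\<close> if every trajectory \<open>\<gamma> = \<Phi>(\<cdot>, x)\<close> solves
  \<open>\<gamma>'(t) = X t (\<gamma> t)\<close>; the velocity \<open>\<gamma>'(t)\<close> is the derivation \<open>h \<mapsto> (h \<circ> \<gamma>)'(t)\<close>.
  The solution maps of a general time-dependent vector field do not satisfy the group law required
  here; it is what makes the Koopman operators a one-parameter group, and it forces \<open>X t = X 0\<close>
  for all \<open>t\<close>.
\<close>

definition global_flow ::
    "('a::topological_space, 'e::euclidean_space) atlas \<Rightarrow> (real \<times> 'a \<Rightarrow> 'a) \<Rightarrow> bool" where
  "global_flow A \<Phi> \<longleftrightarrow> smooth_map (time_atlas A) A \<Phi> \<and>
     (\<forall>x. \<Phi> (0, x) = x) \<and> (\<forall>s t x. \<Phi> (s + t, x) = \<Phi> (s, \<Phi> (t, x)))"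

definition generates ::
    "('a::topological_space, 'e::euclidean_space) atlas \<Rightarrow> (real \<Rightarrow> 'a vfield) \<Rightarrow>
     (real \<times> 'a \<Rightarrow> 'a) \<Rightarrow> bool" where
  "generates A X \<Phi> \<longleftrightarrow> global_flow A \<Phi> \<and>
     (\<forall>x t. \<forall>h\<in>Cinf A.
        ((\<lambda>s. h (\<Phi> (s, x))) has_real_derivative X t (\<Phi> (t, x)) h) (at t))"

definition koopman ::
    "('a::topological_space, 'e::euclidean_space) atlas \<Rightarrow> (real \<times> 'a \<Rightarrow> 'a) \<Rightarrow> real \<Rightarrow>
     ('a \<Rightarrow> real) \<Rightarrow> ('a \<Rightarrow> real)" where
  "koopman A \<Phi> t = (\<lambda>h\<in>Cinf A. h \<circ> (\<lambda>x. \<Phi> (t, x)))"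

end

theory Submission
  imports Defs "HOL-Real_Asymp.Real_Asymp"
begin

text \<open>
  The operators \<open>D\<^sup>j h(X\<^sub>1, \<dots>, X\<^sub>j)\<close> for fixed vector fields span a space that is closed under
  applying vector fields. Since a diffeomorphism \<open>\<Phi>\<^sub>t\<close> pushes vector fields forward, each
  \<open>D\<^sup>j (h \<circ> \<Phi>\<^sub>t)(X\<^sub>1, \<dots>, X\<^sub>j)\<close> is the pullback of such an operator applied to \<open>h\<close>. By tensoriality
  and Hadamard's lemma, on a compact set the norm \<open>\<bar>D\<^sup>j h\<bar>\<close> is controlled by finitely many frame
  tuples; this gives the continuity of \<open>U\<^sub>t\<close>. For \<open>f\<close> smooth on \<open>\<real> \<times> M\<close> the frame components of
  \<open>D\<^sup>j f(s, \<cdot>)\<close> are jointly continuous in \<open>(s, x)\<close>, hence \<open>f(s, \<cdot>) \<rightarrow> f(0, \<cdot>)\<close> in the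
  \<open>C\<^sup>\<infinity>\<close>-topology. Applied to \<open>h \<circ> \<Phi>\<close> this is strong continuity; applied to the difference quotient,
  which extends smoothly to \<open>s = 0\<close>, it is the differential equation.
\<close>

section \<open>Calculus of smooth maps\<close>

text \<open>\<open>Cinf A\<close> holds globally defined functions only, and tangent vectors are
  derivations of it. Coordinates and coordinate fields therefore exist only after multiplication by
  a bump function \<rho>. Since 1 / \<rho> is not a global smooth function, frame identities carry
  powers of \<rho> along, and \<rho> is divided out only where it is known to be nonzero.

  A diffeomorphism \<Phi>_t need not preserve the connection, so a covariant derivative of h o
  \<Phi>_t is a combination of covariant derivatives of h of possibly several orders. This is why
  continuity is expressed by bounding one seminorm by a sum of seminorms of several orders on
  another compact set.

  Each seminorm is a supremum over infinitely many tuples of fields, and a real \<open>Sup\<close>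
  says nothing until the set is known to be bounded. The reduction to finitely many frame tuples
  supplies this boundedness, and it also turns uniformity over all tuples into uniformity of
  finitely many continuous functions on a compact set.\<close>

lemma Ck_on_cong:
  assumes "open S" "\<And>x. x \<in> S \<Longrightarrow> f x = g x" "Ck_on k S f"
  shows "Ck_on k S g"
  using assms
proof (induction k arbitrary: f g)
  case 0
  then show ?case by (simp cong: continuous_on_cong)
next
  case (Suc k)
  have D: "(g has_derivative frechet_derivative f (at x)) (at x)" if "x \<in> S" for x
    using Suc.prems that has_derivative_transform_within_open[OF _ Suc.prems(1) that Suc.prems(2)]
    by (auto simp: frechet_derivative_works)
  have eq: "frechet_derivative f (at x) = frechet_derivative g (at x)" if "x \<in> S" for x
    using frechet_derivative_at[OF D[OF that]] .
  show ?case
    using D Suc.IH[of "\<lambda>x. frechet_derivative f (at x) v" "\<lambda>x. frechet_derivative g (at x) v" for v]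
      Suc.prems(1,3) eq
    by (auto simp: differentiable_def)
qed

text \<open>\<open>frechet_derivative\<close> is a choice term, while calculus rules deliver some
  explicit \<open>f'\<close>. Uniqueness of the derivative identifies the two on the open set
  \<open>S\<close>.\<close>

lemma Ck_on_SucI:
  assumes "open S" "\<And>x. x \<in> S \<Longrightarrow> (f has_derivative f' x) (at x)"
    and "\<And>v. Ck_on k S (\<lambda>x. f' x v)"
  shows "Ck_on (Suc k) S f"
proof -
  have "f' x = frechet_derivative f (at x)" if "x \<in> S" for x
    using frechet_derivative_at[OF assms(2)[OF that]] .
  then show ?thesis
    using assms Ck_on_cong[OF assms(1), of "\<lambda>x. f' x v" "\<lambda>x. frechet_derivative f (at x) v" for v]
    by (auto simp: differentiable_def)
qed

lemma Ck_on_has_derivative: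
  "Ck_on (Suc k) S f \<Longrightarrow> x \<in> S \<Longrightarrow> (f has_derivative frechet_derivative f (at x)) (at x)"
  by (auto simp: frechet_derivative_works)

lemma Ck_on_frechet_derivative:
  "Ck_on (Suc k) S f \<Longrightarrow> Ck_on k S (\<lambda>x. frechet_derivative f (at x) v)"
  by simp

lemma Ck_on_pred: "Ck_on (Suc k) S f \<Longrightarrow> Ck_on k S f"
proof (induction k arbitrary: f)
  case 0
  then show ?case
    by (auto intro!: continuous_at_imp_continuous_on differentiable_imp_continuous_within)
next
  case (Suc k)
  then show ?case by simp
qed

lemma Ck_on_subset: "Ck_on k S f \<Longrightarrow> T \<subseteq> S \<Longrightarrow> Ck_on k T f"
  by (induction k arbitrary: f) (auto intro: continuous_on_subset)

lemma Ck_on_local: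
  assumes "\<And>x. x \<in> S \<Longrightarrow> \<exists>T. open T \<and> x \<in> T \<and> Ck_on k T f"
  shows "Ck_on k S f"
  using assms
proof (induction k arbitrary: f)
  case 0
  then show ?case
    by (auto intro!: continuous_at_imp_continuous_on) (metis continuous_on_eq_continuous_at)
next
  case (Suc k)
  then show ?case by (simp, meson)
qed

lemma Ck_on_const: "Ck_on k S (\<lambda>x. c)"
  by (induction k arbitrary: c) auto

lemma Ck_on_linear:
  assumes "bounded_linear f" "open S"
  shows "Ck_on k S f"
proof (cases k)
  case 0
  then show ?thesis using assms by (simp add: linear_continuous_on)
next
  case (Suc l)
  then show ?thesis
    using Ck_on_SucI[OF assms(2) bounded_linear_imp_has_derivative[OF assms(1)]] Ck_on_const by blast
qed

lemma Ck_on_add: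
  assumes "open S" "Ck_on k S f" "Ck_on k S g"
  shows "Ck_on k S (\<lambda>x. f x + g x)"
  using assms(2,3)
proof (induction k arbitrary: f g)
  case 0
  then show ?case by (simp add: continuous_on_add)
next
  case (Suc k)
  show ?case
    by (rule Ck_on_SucI[OF assms(1) has_derivative_add[OF Suc.prems[THEN Ck_on_has_derivative]]])
      (auto intro!: Suc.IH Suc.prems[THEN Ck_on_frechet_derivative])
qed

text \<open>One induction serves products, scaling and inner products. Both functions vary in it,
  because the product rule pairs each factor with the derivative of the other.\<close>

lemma Ck_on_bilinear:
  assumes "bounded_bilinear mul" "open S" "Ck_on k S f" "Ck_on k S g"
  shows "Ck_on k S (\<lambda>x. mul (f x) (g x))"
  using assms(3,4)
proof (induction k arbitrary: f g)
  case 0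
  then show ?case
    by (simp add: bounded_bilinear.continuous_on[OF assms(1)])
next
  case (Suc k)
  show ?case
    by (rule Ck_on_SucI[OF assms(2)
          bounded_bilinear.FDERIV[OF assms(1) Suc.prems[THEN Ck_on_has_derivative]]])
      (auto intro!: Suc.IH Ck_on_add[OF assms(2)]
        Suc.prems[THEN Ck_on_frechet_derivative] Suc.prems[THEN Ck_on_pred])
qed

lemma Ck_on_linear_image:
  assumes "bounded_linear L" "open S" "Ck_on k S f"
  shows "Ck_on k S (\<lambda>x. L (f x))"
  using assms(3)
proof (induction k arbitrary: f)
  case 0
  then show ?case
    by (simp add: bounded_linear.continuous_on[OF assms(1)])
next
  case (Suc k)
  show ?case
    by (rule Ck_on_SucI[OF assms(2)
          bounded_linear.has_derivative[OF assms(1) Suc.prems[THEN Ck_on_has_derivative]]])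
      (auto intro!: Suc.IH Suc.prems[THEN Ck_on_frechet_derivative])
qed

lemma Ck_on_sum:
  assumes "open S" "\<And>i. i \<in> I \<Longrightarrow> Ck_on k S (f i)"
  shows "Ck_on k S (\<lambda>x. \<Sum>i\<in>I. f i x)"
  using assms(2)
  by (induction I rule: infinite_finite_induct) (auto intro!: Ck_on_add[OF assms(1)] Ck_on_const)

lemma Ck_on_compose:
  fixes f :: "'d::euclidean_space \<Rightarrow> 'e::euclidean_space"
  assumes "open S" "Ck_on k S f" "f ` S \<subseteq> T" "Ck_on k T g"
  shows "Ck_on k S (\<lambda>x. g (f x))"
  using assms(2,4)
proof (induction k arbitrary: g)
  case 0
  then show ?case using assms(3) by (auto intro: continuous_on_compose2)
next
  case (Suc k)
  let ?Df = "\<lambda>x. frechet_derivative f (at x)" and ?Dg = "\<lambda>x. frechet_derivative g (at x)"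
  have D: "((\<lambda>x. g (f x)) has_derivative (\<lambda>v. ?Dg (f x) (?Df x v))) (at x)" if "x \<in> S" for x
    using that assms(3) Ck_on_has_derivative[OF Suc.prems(1) that]
    by (intro has_derivative_compose[of f "?Df x" x UNIV g]) (auto intro: Ck_on_has_derivative[OF Suc.prems(2)])
  \<comment> \<open>The chain rule evaluates the derivative of \<open>g\<close> in a direction that
    varies with \<open>x\<close>, whereas \<open>Ck_on\<close> controls it in fixed directions only.
    Expanding the direction in \<open>Basis\<close> separates the two.\<close>
  have eq: "(\<Sum>b\<in>Basis. (?Df x v \<bullet> b) *\<^sub>R ?Dg (f x) b) = ?Dg (f x) (?Df x v)" if "x \<in> S" for x v
  proof -
    have "linear (?Dg (f x))"
      using assms(3) that Ck_on_has_derivative[OF Suc.prems(2)] has_derivative_linear by blast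
    then have "?Dg (f x) (\<Sum>b\<in>Basis. (?Df x v \<bullet> b) *\<^sub>R b) =
        (\<Sum>b\<in>Basis. (?Df x v \<bullet> b) *\<^sub>R ?Dg (f x) b)"
      by (simp add: linear_sum linear_cmul)
    then show ?thesis
      by (simp add: euclidean_representation)
  qed
  have C: "Ck_on k S (\<lambda>x. ?Dg (f x) (?Df x v))" for v
  proof (rule Ck_on_cong[OF assms(1) eq])
    show "Ck_on k S (\<lambda>x. \<Sum>b\<in>Basis. (?Df x v \<bullet> b) *\<^sub>R ?Dg (f x) b)"
      by (intro Ck_on_sum assms(1) Ck_on_bilinear[OF bounded_bilinear_scaleR]
          Ck_on_linear_image[OF bounded_linear_inner_left]
          Suc.IH Suc.prems(1)[THEN Ck_on_pred] Ck_on_frechet_derivative[OF Suc.prems(1)]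
          Ck_on_frechet_derivative[OF Suc.prems(2)])
  qed
  show ?case
    by (rule Ck_on_SucI[OF assms(1) D]) (assumption | rule C)+
qed

text \<open>In the derivative - f' / f^2 the function 1 / f occurs undifferentiated, so its
  smoothness of order k, the induction hypothesis, gives order k + 1.\<close>

lemma Ck_on_inverse:
  fixes f :: "'e::euclidean_space \<Rightarrow> real"
  assumes "open S" "Ck_on k S f" "\<And>x. x \<in> S \<Longrightarrow> f x \<noteq> 0"
  shows "Ck_on k S (\<lambda>x. inverse (f x))"
  using assms(2)
proof (induction k)
  case 0
  then show ?case using assms(3) by (auto intro!: continuous_on_inverse)
next
  case (Suc k)
  have D: "((\<lambda>x. inverse (f x)) has_derivative
      (\<lambda>v. - (inverse (f x) * frechet_derivative f (at x) v * inverse (f x)))) (at x)"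
    if "x \<in> S" for x
    by (rule Deriv.has_derivative_inverse[OF assms(3)[OF that] Ck_on_has_derivative[OF Suc.prems that]])
  show ?case
    by (rule Ck_on_SucI[OF assms(1) D])
      (use Suc in \<open>auto intro!: Ck_on_linear_image[OF bounded_linear_minus[OF bounded_linear_ident]]
        Ck_on_bilinear[OF bounded_bilinear_mult] assms(1) Suc.IH Ck_on_pred[OF Suc.prems]\<close>)
qed

text \<open>Differentiation under the integral sign. The direction \<open>Q v\<close> produces an
  extra factor t; the weight \<open>t ^ m\<close> absorbs it, so that the family of integrals is
  closed under differentiation. Hadamard coefficients (\<open>P\<close> = 0) and averages over time
  are the two instances.\<close>

lemma Ck_on_integral:
  fixes u :: "'e::euclidean_space \<Rightarrow> real" and P Q :: "'d::euclidean_space \<Rightarrow> 'e"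
  assumes S': "open S'" and P: "bounded_linear P" and Q: "bounded_linear Q"
    and sub: "\<And>x t. x \<in> S' \<Longrightarrow> t \<in> {0..1} \<Longrightarrow> a + P x + t *\<^sub>R Q x \<in> S"
    and u: "Ck_on k S u"
  shows "Ck_on k S' (\<lambda>x. integral {0..1} (\<lambda>t. t ^ m * u (a + P x + t *\<^sub>R Q x)))"
  using u
proof (induction k arbitrary: u m)
  case 0
  have "continuous_on (S' \<times> {0..1}) (\<lambda>y. snd y ^ m * u (a + P (fst y) + snd y *\<^sub>R Q (fst y)))"
    using 0 sub
    by (auto intro!: continuous_intros continuous_on_compose2[of S u] bounded_linear.continuous_on[OF P]
        bounded_linear.continuous_on[OF Q])
  then show ?case
    using integral_continuous_on_param[of S' 0 1 "\<lambda>x t. t ^ m * u (a + P x + t *\<^sub>R Q x)"]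
    by (simp add: case_prod_unfold)
next
  case (Suc k)
  let ?L = "\<lambda>x t. a + P x + t *\<^sub>R Q x"
  let ?D = "\<lambda>y. frechet_derivative u (at y)"
  let ?f' = "\<lambda>x v. integral {0..1} (\<lambda>t. t ^ m * ?D (?L x t) (P v)) +
                   integral {0..1} (\<lambda>t. t ^ Suc m * ?D (?L x t) (Q v))"
  \<comment> \<open>\<open>leibniz_rule\<close> wants the derivative as a jointly continuous
    \<open>blinfun\<close>; in finite dimension continuity is checked on each vector
    separately.\<close>
  let ?F = "\<lambda>x t. Blinfun (\<lambda>v. t ^ m * ?D (?L x t) (P v + t *\<^sub>R Q v))"
  have Du: "(u has_derivative ?D y) (at y)" if "y \<in> S" for y
    using Ck_on_has_derivative[OF Suc.prems that] .
  have cont_u: "continuous_on S u"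
    using Du by (meson continuous_at_imp_continuous_on has_derivative_continuous)
  have cont: "continuous_on (S' \<times> {0..1}) (\<lambda>y. snd y ^ n * ?D (?L (fst y) (snd y)) v)" for n v
  proof -
    have "continuous_on S (\<lambda>y. ?D y v)"
      using Ck_on_frechet_derivative[OF Suc.prems] by (cases k) (auto intro: continuous_at_imp_continuous_on differentiable_imp_continuous_within)
    then show ?thesis
      using sub
      by (auto intro!: continuous_intros continuous_on_compose2[of S "\<lambda>y. ?D y v"] bounded_linear.continuous_on[OF P]
          bounded_linear.continuous_on[OF Q])
  qed
  have cont1: "continuous_on {0..1} (\<lambda>t. t ^ n * ?D (?L x t) v)" if "x \<in> S'" for x n v
  proof -
    have "continuous_on {0..1} (Pair x)"
      by (intro continuous_intros)
    then show ?thesis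
      using continuous_on_compose2[OF cont[of n v], of "{0..1}" "Pair x"] that by auto
  qed
  have bl: "bounded_linear (\<lambda>v. t ^ m * ?D (?L x t) (P v + t *\<^sub>R Q v))"
    if "x \<in> S'" "t \<in> {0..1}" for x t
    using bounded_linear_compose[OF has_derivative_bounded_linear[OF Du[OF sub[OF that]]]
        bounded_linear_add[OF P bounded_linear_compose[OF bounded_linear_scaleR_right Q]]]
    by (intro bounded_linear_const_mult)
  have split: "t ^ m * ?D (?L x t) (P v + t *\<^sub>R Q v) =
      t ^ m * ?D (?L x t) (P v) + t ^ Suc m * ?D (?L x t) (Q v)"
    if "x \<in> S'" "t \<in> {0..1}" for x t v
    using has_derivative_linear[OF Du[OF sub[OF that]]]
    by (simp add: linear_add linear_cmul algebra_simps)
  have F: "blinfun_apply (?F x t) v =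
      t ^ m * ?D (?L x t) (P v) + t ^ Suc m * ?D (?L x t) (Q v)"
    if "x \<in> S'" "t \<in> {0..1}" for x t v
    by (subst bounded_linear_Blinfun_apply[OF bl[OF that]]) (rule split[OF that])
  have D: "((\<lambda>x. integral {0..1} (\<lambda>t. t ^ m * u (?L x t))) has_derivative ?f' x0) (at x0)"
    if x0: "x0 \<in> S'" for x0
  proof -
    \<comment> \<open>\<open>leibniz_rule\<close> needs a convex parameter set, hence the passage to
      a ball.\<close>
    obtain r where r: "r > 0" "ball x0 r \<subseteq> S'"
      using S' x0 openE by blast
    have contF: "continuous_on (ball x0 r \<times> cbox 0 1) (\<lambda>(x, t). ?F x t)"
    proof (rule continuous_on_blinfun_componentwise)
      fix i :: 'd
      have "continuous_on (ball x0 r \<times> {0..1})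
          (\<lambda>y. snd y ^ m * ?D (?L (fst y) (snd y)) (P i) + snd y ^ Suc m * ?D (?L (fst y) (snd y)) (Q i))"
        using r(2) by (intro continuous_on_add continuous_on_subset[OF cont]) auto
      then show "continuous_on (ball x0 r \<times> cbox 0 1) (\<lambda>x. blinfun_apply (case x of (x, t) \<Rightarrow> ?F x t) i)"
        unfolding cbox_interval
        by (rule continuous_on_eq)
          (use r(2) in \<open>auto simp: F subset_iff simp del: power_Suc\<close>)
    qed
    have "((\<lambda>x. integral (cbox 0 1) (\<lambda>t. t ^ m * u (?L x t))) has_derivative
        integral (cbox 0 1) (?F x0)) (at x0 within ball x0 r)"
    proof (rule leibniz_rule[OF _ _ contF])
      fix x t assume x: "x \<in> ball x0 r" and t: "t \<in> cbox (0::real) 1"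
      have xt: "x \<in> S'" "t \<in> {0..1}"
        using x t r(2) by auto
      have "((\<lambda>x. ?L x t) has_derivative (\<lambda>v. P v + t *\<^sub>R Q v)) (at x)"
        by (auto intro!: derivative_eq_intros bounded_linear_imp_has_derivative[OF P]
            bounded_linear_imp_has_derivative[OF Q])
      then have "((\<lambda>x. u (?L x t)) has_derivative (\<lambda>v. ?D (?L x t) (P v + t *\<^sub>R Q v))) (at x)"
        by (rule has_derivative_compose) (rule Du[OF sub[OF xt]])
      then have "((\<lambda>x. t ^ m * u (?L x t)) has_derivative (\<lambda>v. t ^ m * ?D (?L x t) (P v + t *\<^sub>R Q v))) (at x)"
        by (rule has_derivative_mult_right)
      then show "((\<lambda>x. t ^ m * u (?L x t)) has_derivative blinfun_apply (?F x t)) (at x within ball x0 r)"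
        using bl[OF xt] by (simp add: bounded_linear_Blinfun_apply has_derivative_at_withinI)
    next
      fix x assume "x \<in> ball x0 r"
      then have "continuous_on {0..1} (\<lambda>t. t ^ m * u (?L x t))"
        using r(2) sub by (auto intro!: continuous_intros continuous_on_compose2[OF cont_u])
      then show "(\<lambda>t. t ^ m * u (?L x t)) integrable_on cbox 0 1"
        by (simp add: integrable_continuous_real)
    qed (use r in auto)
    moreover have "blinfun_apply (integral (cbox 0 1) (?F x0)) = ?f' x0"
    proof
      fix v
      have "continuous_on {0..1} (?F x0)"
      proof -
        have "continuous_on {0..1::real} (Pair x0)"
          by (intro continuous_intros)
        moreover have "Pair x0 ` {0..1::real} \<subseteq> ball x0 r \<times> cbox 0 1"
          using r(1) by auto
        ultimately show ?thesis
          using continuous_on_compose2[OF contF] by fastforce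
      qed
      then have "?F x0 integrable_on {0..1}"
        by (rule integrable_continuous_real)
      then have "blinfun_apply (integral (cbox 0 1) (?F x0)) v =
          integral {0..1} (\<lambda>t. blinfun_apply (?F x0 t) v)"
        by (simp add: blinfun_apply_integral)
      also have "\<dots> = integral {0..1} (\<lambda>t. t ^ m * ?D (?L x0 t) (P v) + t ^ Suc m * ?D (?L x0 t) (Q v))"
        by (intro integral_cong) (simp add: F x0 del: power_Suc)
      also have "\<dots> = ?f' x0 v"
        by (intro integral_add integrable_continuous_real cont1 x0)
      finally show "blinfun_apply (integral (cbox 0 1) (?F x0)) v = ?f' x0 v" .
    qed
    ultimately show ?thesis
      using r(1) by (simp add: at_within_open[of x0 "ball x0 r"])
  qed
  show ?case
  proof (rule Ck_on_SucI[OF S' D])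
    fix v
    show "Ck_on k S' (\<lambda>x. ?f' x v)"
      by (rule Ck_on_add[OF S' Suc.IH[of "\<lambda>y. ?D y (P v)"] Suc.IH[of "\<lambda>y. ?D y (Q v)"]])
        (rule Ck_on_frechet_derivative[OF Suc.prems])+
  qed
qed

text \<open>The case n = 0 is the classical function exp (-1/x) that vanishes to infinite order at
  0. Allowing powers of x in the denominator makes the family closed under differentiation.\<close>

definition flat :: "nat \<Rightarrow> real \<Rightarrow> real" where
  "flat n x = (if x > 0 then exp (- 1 / x) / x ^ n else 0)"

lemma flat_tendsto_0: "(flat n \<longlongrightarrow> 0) (at 0)"
proof -
  have "((\<lambda>x::real. exp (- 1 / x) / x ^ n) \<longlongrightarrow> 0) (at_right 0)"
    by real_asymp
  then have "(flat n \<longlongrightarrow> 0) (at_right 0)"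
    by (rule Lim_transform_eventually)
      (auto simp: eventually_at_right_field flat_def intro!: exI[of _ 1])
  moreover have "(flat n \<longlongrightarrow> 0) (at_left 0)"
    by (rule Lim_transform_eventually[OF tendsto_const])
      (auto simp: eventually_at_left_field flat_def intro!: exI[of _ "-1"])
  ultimately show ?thesis
    by (simp add: filterlim_split_at)
qed

lemma flat_has_derivative:
  "(flat n has_real_derivative flat (n + 2) x - real n * flat (Suc n) x) (at x)"
proof (cases x "0::real" rule: linorder_cases)
  case less
  have "((\<lambda>x. 0) has_real_derivative 0) (at x)"
    by simp
  then have "(flat n has_real_derivative 0) (at x)"
    by (rule has_field_derivative_transform_within_open[where S = "{..<0}"])
      (use less in \<open>auto simp: flat_def\<close>)
  then show ?thesis
    using less by (simp add: flat_def)
next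
  case equal
  \<comment> \<open>Away from 0 this difference quotient is itself a member of the family,
    \<open>flat (Suc n)\<close>, whose limit at 0 is known.\<close>
  have "((\<lambda>y. (flat n y - flat n 0) / (y - 0)) \<longlongrightarrow> 0) (at 0)"
    by (rule Lim_transform_eventually[OF flat_tendsto_0[of "Suc n"]])
      (auto simp: flat_def)
  then show ?thesis
    using equal by (simp add: flat_def has_field_derivative_iff)
next
  case greater
  have "((\<lambda>x. exp (- 1 / x) / x ^ n) has_real_derivative flat (n + 2) x - real n * flat (Suc n) x) (at x)"
    using greater
    by (auto intro!: derivative_eq_intros simp: flat_def field_simps power2_eq_square)
      (cases n; simp add: field_simps)
  then show ?thesis
    by (rule has_field_derivative_transform_within_open[where S = "{0<..}"])
      (use greater in \<open>auto simp: flat_def\<close>)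
qed

lemma Ck_on_flat: "Ck_on k UNIV (flat n)"
proof (induction k arbitrary: n)
  case 0
  show ?case
    using flat_has_derivative by (auto intro!: DERIV_continuous_on)
next
  case (Suc k)
  show ?case
    by (rule Ck_on_SucI[OF open_UNIV flat_has_derivative[unfolded has_field_derivative_def]])
      (auto simp: diff_conv_add_uminus simp del: add_uminus_conv_diff intro!: Ck_on_add Ck_on_bilinear[OF bounded_bilinear_mult] Ck_on_const Suc
        Ck_on_linear_image[OF bounded_linear_minus[OF bounded_linear_ident]])
qed

text \<open>The fundamental theorem of calculus on the segment from \<open>p\<close> to
  \<open>x\<close>: \<open>g b x\<close> is the mean of the partial derivative over it. The base
  point is any point of the ball, since \<open>frame\<close> uses one fixed ball for all nearby
  points.\<close>

lemma hadamard:
  fixes u :: "'e::euclidean_space \<Rightarrow> real"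
  assumes S: "open S" and u: "\<And>k. Ck_on k S u" and sub: "ball a r \<subseteq> S" and p: "p \<in> ball a r"
  shows "\<exists>g. (\<forall>b k. Ck_on k (ball a r) (g b)) \<and>
    (\<forall>x\<in>ball a r. u x = u p + (\<Sum>b\<in>Basis. ((x - p) \<bullet> b) * g b x)) \<and>
    (\<forall>b. g b p = frechet_derivative u (at p) b)"
proof (intro exI conjI allI ballI)
  let ?D = "\<lambda>y. frechet_derivative u (at y)"
  define g where "g = (\<lambda>b x. integral {0..1} (\<lambda>t. ?D (p + t *\<^sub>R (x - p)) b))"
  have seg: "p + t *\<^sub>R (x - p) \<in> ball a r" if "x \<in> ball a r" "t \<in> {0..1}" for x t
    using that p convex_ball[of a r] by (simp add: convex_alt algebra_simps)
  have Du: "(u has_derivative ?D y) (at y)" if "y \<in> ball a r" for y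
    using Ck_on_has_derivative[OF u] that sub by blast
  show "Ck_on k (ball a r) (g b)" for b k
  proof -
    \<comment> \<open>In the variable y = x - p the segment is p + t y, which has the linear form
      required by \<open>Ck_on_integral\<close>; a translation then leads back to x.\<close>
    have "Ck_on k (ball (a - p) r)
        (\<lambda>y. integral {0..1} (\<lambda>t. t ^ 0 * ?D (p + 0 + t *\<^sub>R y) b))"
    proof (rule Ck_on_integral[where S = "ball a r"])
      fix y t assume "y \<in> ball (a - p) r" "t \<in> {0..1::real}"
      then show "p + 0 + t *\<^sub>R y \<in> ball a r"
        using seg[of "p + y" t] by (simp add: dist_norm algebra_simps)
    qed (use u Ck_on_subset[OF Ck_on_frechet_derivative[OF u] sub] in auto)
    moreover have "Ck_on k (ball a r) (\<lambda>x. x + - p)"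
      by (intro Ck_on_add Ck_on_const Ck_on_linear[OF bounded_linear_ident] open_ball)
    moreover have "(\<lambda>x. x + - p) ` ball a r \<subseteq> ball (a - p) r"
      by (auto simp: dist_norm algebra_simps)
    ultimately have "Ck_on k (ball a r)
        (\<lambda>x. integral {0..1} (\<lambda>t. t ^ 0 * ?D (p + 0 + t *\<^sub>R (x + - p)) b))"
      by (rule Ck_on_compose[OF open_ball _ _, rotated -1])
    then show ?thesis by (simp add: g_def)
  qed
  show "g b p = ?D p b" for b
    by (simp add: g_def)
  show "u x = u p + (\<Sum>b\<in>Basis. ((x - p) \<bullet> b) * g b x)" if x: "x \<in> ball a r" for x
  proof -
    let ?L = "\<lambda>t. p + t *\<^sub>R (x - p)"
    have cont: "continuous_on {0..1} (\<lambda>t. ?D (?L t) b)" for b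
    proof -
      have "continuous_on S (\<lambda>y. ?D y b)"
        using Ck_on_frechet_derivative[OF u, of 0 b] by simp
      then show ?thesis
        using seg[OF x] sub
        by (auto intro!: continuous_on_compose2[of S "\<lambda>y. ?D y b"] continuous_intros)
    qed
    have "((\<lambda>t. u (?L t)) has_vector_derivative ?D (?L t) (x - p)) (at t within {0..1})"
      if t: "t \<in> {0..1}" for t
    proof -
      have "(?L has_derivative (\<lambda>s. s *\<^sub>R (x - p))) (at t)"
        by (auto intro!: derivative_eq_intros)
      then have "((\<lambda>t. u (?L t)) has_derivative (\<lambda>s. ?D (?L t) (s *\<^sub>R (x - p)))) (at t)"
        by (rule has_derivative_compose) (rule Du[OF seg[OF x t]])
      then show ?thesis
        using has_derivative_linear[OF Du[OF seg[OF x t]]]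
        by (simp add: has_vector_derivative_def linear_cmul has_derivative_at_withinI)
    qed
    then have "((\<lambda>t. ?D (?L t) (x - p)) has_integral u (?L 1) - u (?L 0)) {0..1}"
      by (intro fundamental_theorem_of_calculus) auto
    then have "u x - u p = integral {0..1} (\<lambda>t. ?D (?L t) (x - p))"
      by (simp add: integral_unique)
    also have "\<dots> = integral {0..1} (\<lambda>t. \<Sum>b\<in>Basis. ((x - p) \<bullet> b) * ?D (?L t) b)"
    proof (rule integral_cong)
      fix t :: real assume "t \<in> {0..1}"
      then have "linear (?D (?L t))"
        using has_derivative_linear[OF Du[OF seg[OF x]]] by blast
      then have "?D (?L t) (\<Sum>b\<in>Basis. ((x - p) \<bullet> b) *\<^sub>R b) = (\<Sum>b\<in>Basis. ((x - p) \<bullet> b) * ?D (?L t) b)"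
        by (simp add: linear_sum linear_cmul)
      then show "?D (?L t) (x - p) = (\<Sum>b\<in>Basis. ((x - p) \<bullet> b) * ?D (?L t) b)"
        by (simp add: euclidean_representation)
    qed
    also have "\<dots> = (\<Sum>b\<in>Basis. ((x - p) \<bullet> b) * g b x)"
      unfolding g_def
      by (subst integral_sum)
        (auto intro!: sum.cong integrable_continuous_real continuous_intros cont simp: integral_mult_right)
    finally show ?thesis by simp
  qed
qed

text \<open>For r > 0 this is positive exactly on the open ball of radius r. The squared norm is
  polynomial, so the centre is not singular.\<close>

lemma Ck_on_bump: "Ck_on k UNIV (\<lambda>x::'e::euclidean_space. flat 0 (r\<^sup>2 - (x - a) \<bullet> (x - a)))"
proof (rule Ck_on_compose[where T = UNIV and g = "flat 0" and f = "\<lambda>x. r\<^sup>2 - (x - a) \<bullet> (x - a)"])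
  have "Ck_on k UNIV (\<lambda>x::'e. r\<^sup>2 + - ((x + - a) \<bullet> (x + - a)))"
    by (intro Ck_on_add Ck_on_const Ck_on_linear_image[OF bounded_linear_minus[OF bounded_linear_ident]]
      Ck_on_bilinear[OF bounded_bilinear_inner] Ck_on_linear[OF bounded_linear_ident] open_UNIV)
  then show "Ck_on k UNIV (\<lambda>x. r\<^sup>2 - (x - a) \<bullet> (x - a))"
    by simp
qed (auto intro: Ck_on_flat)

section \<open>Smooth functions and derivations on a manifold\<close>

lemma CinfI:
  assumes "\<And>U \<phi> k. (U, \<phi>) \<in> A \<Longrightarrow> Ck_on k (\<phi> ` U) (\<lambda>x. h (inv_into U \<phi> x))"
  shows "h \<in> Cinf A"
  using assms by (auto simp: Cinf_def smooth_on_def o_def)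

lemma CinfD:
  "h \<in> Cinf A \<Longrightarrow> (U, \<phi>) \<in> A \<Longrightarrow> Ck_on k (\<phi> ` U) (\<lambda>x. h (inv_into U \<phi> x))"
  by (auto simp: Cinf_def smooth_on_def o_def)

text \<open>Open chart images are all that the arithmetic of smooth functions and derivations
  requires. Isolating this lets the same lemmas serve \<open>time_atlas A\<close>.\<close>

locale open_atlas =
  fixes A :: "('a::topological_space, 'e::euclidean_space) atlas"
  assumes chart_image_open: "(U, \<phi>) \<in> A \<Longrightarrow> open (\<phi> ` U)"
begin

lemma Cinf_const: "(\<lambda>x. c) \<in> Cinf A"
  by (intro CinfI Ck_on_const)

lemma Cinf_add: "h \<in> Cinf A \<Longrightarrow> k \<in> Cinf A \<Longrightarrow> (\<lambda>x. h x + k x) \<in> Cinf A"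
  by (intro CinfI Ck_on_add) (auto intro: CinfD chart_image_open)

lemma Cinf_mult: "h \<in> Cinf A \<Longrightarrow> k \<in> Cinf A \<Longrightarrow> (\<lambda>x. h x * k x) \<in> Cinf A"
  by (intro CinfI Ck_on_bilinear[OF bounded_bilinear_mult]) (auto intro: CinfD chart_image_open)

lemma Cinf_cmult: "h \<in> Cinf A \<Longrightarrow> (\<lambda>x. c * h x) \<in> Cinf A"
  by (intro Cinf_mult Cinf_const)

lemma Cinf_diff: "h \<in> Cinf A \<Longrightarrow> k \<in> Cinf A \<Longrightarrow> (\<lambda>x. h x - k x) \<in> Cinf A"
  using Cinf_add[OF _ Cinf_cmult[of k "-1"], of h] by simp

lemma Cinf_sum: "(\<And>i. i \<in> I \<Longrightarrow> h i \<in> Cinf A) \<Longrightarrow> (\<lambda>x. \<Sum>i\<in>I. h i x) \<in> Cinf A"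
  by (induction I rule: infinite_finite_induct) (auto intro: Cinf_const Cinf_add)

section \<open>Derivations at a point and vector fields\<close>

lemma tangent_lincomb:
  assumes "v \<in> tangent_space A p" "h \<in> Cinf A" "k \<in> Cinf A"
  shows "v (\<lambda>x. a * h x + b * k x) = a * v h + b * v k"
  using assms by (auto simp: tangent_space_def)

lemma tangent_mult:
  assumes "v \<in> tangent_space A p" "h \<in> Cinf A" "k \<in> Cinf A"
  shows "v (\<lambda>x. h x * k x) = h p * v k + k p * v h"
  using assms by (auto simp: tangent_space_def)

lemma tangent_off: "v \<in> tangent_space A p \<Longrightarrow> h \<notin> Cinf A \<Longrightarrow> v h = 0"
  by (auto simp: tangent_space_def)

lemma tangent_add:
  assumes "v \<in> tangent_space A p" "h \<in> Cinf A" "k \<in> Cinf A"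
  shows "v (\<lambda>x. h x + k x) = v h + v k"
  using tangent_lincomb[OF assms, of 1 1] by simp

text \<open>The Leibniz rule for 1 = 1 * 1 reads v 1 = 2 * v 1.\<close>

lemma tangent_const:
  assumes "v \<in> tangent_space A p"
  shows "v (\<lambda>x. c) = 0"
proof -
  have "v (\<lambda>x. 1) = 0"
    using tangent_mult[OF assms Cinf_const Cinf_const, of 1 1] by simp
  then show ?thesis
    using tangent_lincomb[OF assms Cinf_const Cinf_const, of c 1 0 1] by simp
qed

lemma tangent_cmult:
  assumes "v \<in> tangent_space A p" "h \<in> Cinf A"
  shows "v (\<lambda>x. c * h x) = c * v h"
  using tangent_mult[OF assms(1) Cinf_const assms(2)] tangent_const[OF assms(1)] by simp

lemma tangent_sum:
  assumes "v \<in> tangent_space A p" "\<And>i. i \<in> I \<Longrightarrow> h i \<in> Cinf A"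
  shows "v (\<lambda>x. \<Sum>i\<in>I. h i x) = (\<Sum>i\<in>I. v (h i))"
  using assms(2)
  by (induction I rule: infinite_finite_induct)
    (auto simp: tangent_const[OF assms(1)] tangent_add[OF assms(1)] Cinf_sum)

lemma tangent_space_lincomb:
  assumes "v \<in> tangent_space A p" "w \<in> tangent_space A p"
  shows "(\<lambda>h. a * v h + b * w h) \<in> tangent_space A p"
  using assms unfolding tangent_space_def by (simp add: algebra_simps)

lemma tangent_space_sum:
  assumes "\<And>i. i \<in> I \<Longrightarrow> v i \<in> tangent_space A p"
  shows "(\<lambda>h. \<Sum>i\<in>I. c i * v i h) \<in> tangent_space A p"
  using assms
proof (induction I rule: infinite_finite_induct)
  case (insert i I)
  then show ?case
    using tangent_space_lincomb[of "v i" p "\<lambda>h. \<Sum>i\<in>I. c i * v i h" "c i" 1] by simp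
qed (auto simp: tangent_space_def)

lemma vector_fieldD: "X \<in> vector_fields A \<Longrightarrow> X p \<in> tangent_space A p"
  by (simp add: vector_fields_def)

lemma vector_field_Cinf: "X \<in> vector_fields A \<Longrightarrow> h \<in> Cinf A \<Longrightarrow> (\<lambda>p. X p h) \<in> Cinf A"
  by (simp add: vector_fields_def)

lemma vector_field_comb:
  assumes "X \<in> vector_fields A" "Y \<in> vector_fields A" "f \<in> Cinf A" "k \<in> Cinf A"
  shows "vf_comb f X k Y \<in> vector_fields A"
  using assms unfolding vf_comb_def vector_fields_def
  by (auto intro!: tangent_space_lincomb Cinf_add Cinf_mult)

end

locale manifold =
  fixes A :: "('a::{t2_space,second_countable_topology}, 'e::euclidean_space) atlas"
  assumes smooth_manifold: "smooth_manifold A"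

sublocale manifold \<subseteq> open_atlas
  using smooth_manifold by unfold_locales (auto simp: smooth_manifold_def)

context manifold
begin

lemma chart_cover: obtains U \<phi> where "(U, \<phi>) \<in> A" "p \<in> U"
proof -
  have "p \<in> (\<Union>(U, \<phi>)\<in>A. U)"
    using smooth_manifold by (simp add: smooth_manifold_def)
  then show ?thesis using that by auto
qed

context
  fixes U \<phi>
  assumes chart: "(U, \<phi>) \<in> A"
begin

lemma chart_open: "open U"
  using smooth_manifold chart by (auto simp: smooth_manifold_def)

lemma chart_homeo: "homeomorphism U (\<phi> ` U) \<phi> (inv_into U \<phi>)"
  using smooth_manifold chart by (auto simp: smooth_manifold_def)

lemma chart_inv: "p \<in> U \<Longrightarrow> inv_into U \<phi> (\<phi> p) = p"
  using chart_homeo by (simp add: homeomorphism_def)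

lemma chart_cont: "continuous_on U \<phi>"
  using chart_homeo by (simp add: homeomorphism_def)

lemma chart_inv_cont: "continuous_on (\<phi> ` U) (inv_into U \<phi>)"
  using chart_homeo by (simp add: homeomorphism_def)

lemma chart_image_inter_open:
  assumes "open W"
  shows "open (\<phi> ` (U \<inter> W))"
proof -
  have "openin (top_of_set (\<phi> ` U)) (\<phi> ` (U \<inter> W))"
    by (rule homeomorphism_imp_open_map[OF chart_homeo]) (use assms in auto)
  then show ?thesis
    using chart_image_open[OF chart] openin_open_eq by blast
qed

lemma transition:
  assumes "(V, \<psi>) \<in> A"
  shows "Ck_on k (\<phi> ` (U \<inter> V)) (\<lambda>x. \<psi> (inv_into U \<phi> x))"
  using smooth_manifold chart assms by (fastforce simp: smooth_manifold_def smooth_on_def o_def)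

text \<open>The bump vanishes on the boundary of the ball, so that the extension is smooth.\<close>

lemma bump_extension_Cinf:
  assumes T: "open T" "cball a r \<subseteq> T" "T \<subseteq> \<phi> ` U" and u: "\<And>k. Ck_on k T u" and r: "r > 0"
  shows "(\<lambda>p. if p \<in> U then flat 0 (r\<^sup>2 - (\<phi> p - a) \<bullet> (\<phi> p - a)) * u (\<phi> p) else 0) \<in> Cinf A"
    (is "?H \<in> _")
proof (rule CinfI, rule Ck_on_local)
  fix V \<psi> k x assume V: "(V, \<psi>) \<in> A" and "x \<in> \<psi> ` V"
  then obtain q where q: "q \<in> V" "x = \<psi> q" by auto
  let ?w = "\<lambda>y. flat 0 (r\<^sup>2 - (y - a) \<bullet> (y - a)) * u y"
  have image_open: "open (\<psi> ` (V \<inter> W))" if "open W" for W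
    using manifold.chart_image_inter_open[OF manifold_axioms V that] .
  have inv: "inv_into V \<psi> (\<psi> p) = p" if "p \<in> V" for p
    using manifold.chart_inv[OF manifold_axioms V that] .
  have w0: "?w y = 0" if "y \<notin> ball a r" for y
  proof -
    have "r \<le> norm (y - a)"
      using that by (simp add: dist_norm norm_minus_commute)
    then have "r\<^sup>2 \<le> (y - a) \<bullet> (y - a)"
      using r by (simp add: power2_norm_eq_inner[symmetric] power_mono)
    then show ?thesis by (simp add: flat_def)
  qed
  show "\<exists>T. open T \<and> x \<in> T \<and> Ck_on k T (\<lambda>x. ?H (inv_into V \<psi> x))"
  proof (cases "q \<in> U \<and> \<phi> q \<in> T")
    case True
    define W where "W = U \<inter> \<phi> -` T"
    have W: "open W"
      using continuous_open_preimage[OF chart_cont chart_open T(1)] by (simp add: W_def)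
    have w: "Ck_on k T ?w"
      by (intro Ck_on_bilinear[OF bounded_bilinear_mult] u T(1) Ck_on_subset[OF Ck_on_bump]) auto
    have "Ck_on k (\<psi> ` (V \<inter> W)) (\<lambda>y. \<phi> (inv_into V \<psi> y))"
      by (rule Ck_on_subset[OF manifold.transition[OF manifold_axioms V chart]]) (auto simp: W_def)
    then have "Ck_on k (\<psi> ` (V \<inter> W)) (\<lambda>y. ?w (\<phi> (inv_into V \<psi> y)))"
      by (rule Ck_on_compose[OF image_open[OF W] _ _ w]) (auto simp: W_def inv)
    then have "Ck_on k (\<psi> ` (V \<inter> W)) (\<lambda>y. ?H (inv_into V \<psi> y))"
      by (rule Ck_on_cong[OF image_open[OF W], rotated]) (auto simp: W_def inv)
    then show ?thesis
      using image_open[OF W] q True by (auto simp: W_def)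
  next
    case False
    \<comment> \<open>\<open>K\<close> is compact, hence closed because M is Hausdorff, and the
      extension is 0 on the open complement. As \<open>K\<close> is contained in the preimage of
      \<open>T\<close>, the two cases cover M by open sets.\<close>
    define K where "K = inv_into U \<phi> ` cball a r"
    have "compact K"
      unfolding K_def using T
      by (intro compact_continuous_image continuous_on_subset[OF chart_inv_cont]) auto
    then have W: "open (- K)"
      by (simp add: compact_imp_closed open_Compl)
    have q_notin: "q \<notin> K"
      using False T by (auto simp: K_def inv_into_into f_inv_into_f subset_iff)
    have H0: "?H p = 0" if "p \<notin> K" for p
    proof (cases "p \<in> U")
      case True
      have "\<phi> p \<notin> ball a r"
      proof
        assume "\<phi> p \<in> ball a r"
        then have "inv_into U \<phi> (\<phi> p) \<in> K"
          unfolding K_def by (intro imageI) auto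
        then show False
          using that chart_inv[OF True] by simp
      qed
      then show ?thesis
        using w0 by simp
    qed simp
    have "0 = ?H (inv_into V \<psi> y)" if y: "y \<in> \<psi> ` (V \<inter> - K)" for y
    proof -
      obtain p where p: "p \<in> V" "p \<notin> K" "y = \<psi> p"
        using y by blast
      show ?thesis
        unfolding p(3) inv[OF p(1)] by (rule H0[OF p(2), symmetric])
    qed
    then have "Ck_on k (\<psi> ` (V \<inter> - K)) (\<lambda>y. ?H (inv_into V \<psi> y))"
      by (rule Ck_on_cong[OF image_open[OF W] _ Ck_on_const])
    then show ?thesis
      using image_open[OF W] q q_notin by (auto intro!: exI[of _ "\<psi> ` (V \<inter> - K)"])
  qed
qed

end

lemma Cinf_continuous:
  assumes "h \<in> Cinf A"
  shows "continuous_on UNIV h"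
proof (rule continuous_at_imp_continuous_on, rule ballI)
  fix p
  obtain U \<phi> where U: "(U, \<phi>) \<in> A" "p \<in> U" using chart_cover by blast
  have "continuous_on U (\<lambda>q. h (inv_into U \<phi> (\<phi> q)))"
    using CinfD[OF assms U(1), of 0]
    by (intro continuous_on_compose2[OF _ chart_cont[OF U(1)]]) auto
  then have "continuous_on U h"
    by (rule continuous_on_eq) (auto simp: chart_inv[OF U(1)])
  then show "isCont h p"
    using chart_open[OF U(1)] U(2) continuous_on_eq_continuous_at by blast
qed

text \<open>
  By Hadamard's lemma a derivation at \<open>p\<close> is determined by the first partial derivatives at \<open>p\<close>;
  multiplying by a bump function \<open>\<rho>\<close> makes everything globally defined.
\<close>

lemma frame:
  assumes chart: "(U, \<phi>) \<in> A" and p0: "p0 \<in> U"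
  obtains \<rho> Y E where "\<rho> \<in> Cinf A" "\<rho> p0 \<noteq> 0" "\<And>p. \<rho> p \<noteq> 0 \<Longrightarrow> p \<in> U"
    and "\<And>b. Y b \<in> Cinf A" and "\<And>b. E b \<in> vector_fields A"
    and "\<And>p v h. v \<in> tangent_space A p \<Longrightarrow>
          \<rho> p ^ 3 * v h = (\<Sum>b\<in>Basis. (\<rho> p * v (Y b) - Y b p * v \<rho>) * E b p h)"
    and "\<And>b p h. h \<in> Cinf A \<Longrightarrow> p \<in> U \<Longrightarrow>
          E b p h = \<rho> p * frechet_derivative (\<lambda>x. h (inv_into U \<phi> x)) (at (\<phi> p)) b"
    and "\<And>c. (\<And>h. h \<in> Cinf A \<Longrightarrow> (\<Sum>b\<in>Basis. c b * E b p0 h) = 0) \<Longrightarrow> \<forall>b\<in>Basis. c b = 0"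
proof -
  define a where "a = \<phi> p0"
  obtain r' where r': "r' > 0" "ball a r' \<subseteq> \<phi> ` U"
    using chart_image_open[OF chart] p0 openE a_def by blast
  \<comment> \<open>Halving leaves a margin: the closed ball carrying the bump lies in the open ball
    on which the function to be cut off is smooth.\<close>
  define r where "r = r' / 2"
  have r: "r > 0" "cball a r \<subseteq> ball a r'"
    using r'(1) by (auto simp: r_def)
  define \<beta> where "\<beta> = (\<lambda>x::'e. flat 0 (r\<^sup>2 - (x - a) \<bullet> (x - a)))"
  define ext where "ext = (\<lambda>u p. if p \<in> U then \<beta> (\<phi> p) * u (\<phi> p) else 0 :: real)"
  define \<rho> where "\<rho> = ext (\<lambda>_. 1)"
  define Y where "Y = (\<lambda>b. ext (\<lambda>x. x \<bullet> b))"
  define D where "D = (\<lambda>h p. frechet_derivative (\<lambda>x. h (inv_into U \<phi> x) :: real) (at (\<phi> p)))"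
  \<comment> \<open>The coordinate field in direction b, cut off by \<rho>. The value 0 on nonsmooth
    functions is the convention of \<open>tangent_space\<close>.\<close>
  define E where "E = (\<lambda>b p h. if h \<in> Cinf A \<and> p \<in> U then \<rho> p * D h p b else 0)"
  have ext_Cinf: "ext u \<in> Cinf A" if "\<And>k. Ck_on k (ball a r') u" for u
    unfolding ext_def \<beta>_def
    by (rule bump_extension_Cinf[OF chart open_ball r(2) r'(2) that r(1)])
  have \<rho>: "\<rho> \<in> Cinf A"
    unfolding \<rho>_def by (intro ext_Cinf Ck_on_const)
  have Y: "Y b \<in> Cinf A" for b
    unfolding Y_def by (intro ext_Cinf Ck_on_linear bounded_linear_inner_left open_ball)
  have \<rho>0: "\<rho> p0 \<noteq> 0"
    using r(1) p0 by (simp add: \<rho>_def ext_def \<beta>_def a_def flat_def)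
  have \<rho>_ball: "p \<in> U \<and> \<phi> p \<in> ball a r'" if "\<rho> p \<noteq> 0" for p
  proof -
    from that have p: "p \<in> U" and "\<beta> (\<phi> p) \<noteq> 0"
      by (auto simp: \<rho>_def ext_def split: if_splits)
    then have "(\<phi> p - a) \<bullet> (\<phi> p - a) < r\<^sup>2"
      by (auto simp: \<beta>_def flat_def split: if_splits)
    then have "norm (\<phi> p - a) < r"
      using r(1) by (simp add: power2_norm_eq_inner[symmetric] power2_less_imp_less)
    then show ?thesis
      using p r(1) by (auto simp: dist_norm norm_minus_commute r_def)
  qed
  have Dh: "((\<lambda>x. h (inv_into U \<phi> x)) has_derivative D h p) (at (\<phi> p))"
    if "h \<in> Cinf A" "p \<in> U" for h p
    unfolding D_def using Ck_on_has_derivative[OF CinfD[OF that(1) chart]] that(2) by blast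
  have E: "E b \<in> vector_fields A" for b
    unfolding vector_fields_def mem_Collect_eq
  proof (intro conjI allI ballI)
    fix p
    have lin: "D (\<lambda>x. s * h x + t * k x) p b = s * D h p b + t * D k p b"
      if "h \<in> Cinf A" "k \<in> Cinf A" "p \<in> U" for h k s t
    proof -
      have "((\<lambda>x. s * h (inv_into U \<phi> x) + t * k (inv_into U \<phi> x)) has_derivative
          (\<lambda>v. s * D h p v + t * D k p v)) (at (\<phi> p))"
        using that by (intro has_derivative_add has_derivative_mult_right Dh)
      then show ?thesis
        by (subst D_def) (simp add: frechet_derivative_at[symmetric])
    qed
    have leib: "D (\<lambda>x. h x * k x) p b = h p * D k p b + k p * D h p b"
      if "h \<in> Cinf A" "k \<in> Cinf A" "p \<in> U" for h k
    proof -
      have "((\<lambda>x. h (inv_into U \<phi> x) * k (inv_into U \<phi> x)) has_derivative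
          (\<lambda>v. h (inv_into U \<phi> (\<phi> p)) * D k p v + D h p v * k (inv_into U \<phi> (\<phi> p)))) (at (\<phi> p))"
        using that by (intro has_derivative_mult Dh)
      then show ?thesis
        by (subst D_def) (simp add: frechet_derivative_at[symmetric] chart_inv[OF chart] that)
    qed
    have "Cinf A \<noteq> {}" using \<rho> by auto
    then show "E b p \<in> tangent_space A p"
      unfolding tangent_space_def E_def
      by (auto simp: lin leib algebra_simps intro!: Cinf_add Cinf_cmult Cinf_mult)
  next
    fix h assume h: "h \<in> Cinf A"
    have "Ck_on k (\<phi> ` U) (\<lambda>x. frechet_derivative (\<lambda>x. h (inv_into U \<phi> x)) (at x) b)" for k
      by (rule Ck_on_frechet_derivative[OF CinfD[OF h chart]])
    then have "ext (\<lambda>x. frechet_derivative (\<lambda>x. h (inv_into U \<phi> x)) (at x) b) \<in> Cinf A"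
      by (intro ext_Cinf Ck_on_subset[OF _ r'(2)])
    also have "ext (\<lambda>x. frechet_derivative (\<lambda>x. h (inv_into U \<phi> x)) (at x) b) = (\<lambda>p. E b p h)"
      using h by (auto simp: ext_def E_def \<rho>_def D_def)
    finally show "(\<lambda>p. E b p h) \<in> Cinf A" .
  qed
  \<comment> \<open>Origin of the cube: two factors \<rho> cut off the coordinate differences and
    the Hadamard coefficients, and a third turns the product of \<rho> with a coordinate of
    \<open>\<phi> p\<close> into \<open>Y b p\<close>. The coefficients then are smooth functions of
    p on all of M whenever v comes from a vector field.\<close>
  have deriv: "\<rho> p ^ 3 * v h = (\<Sum>b\<in>Basis. (\<rho> p * v (Y b) - Y b p * v \<rho>) * E b p h)"
    if v: "v \<in> tangent_space A p" for p v h
  proof (cases "h \<in> Cinf A \<and> \<rho> p \<noteq> 0")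
    case False
    then consider "h \<notin> Cinf A" | "\<rho> p = 0" by blast
    then show ?thesis
    proof cases
      case 1
      then show ?thesis using tangent_off[OF v] by (simp add: E_def)
    next
      case 2
      then have "E b p h = 0" for b by (simp add: E_def)
      then show ?thesis using 2 by simp
    qed
  next
    case True
    then have h: "h \<in> Cinf A" and p: "p \<in> U" "\<phi> p \<in> ball a r'"
      using \<rho>_ball by auto
    let ?u = "\<lambda>x. h (inv_into U \<phi> x)"
    obtain g where g: "\<And>b k. Ck_on k (ball a r') (g b)"
      "\<And>x. x \<in> ball a r' \<Longrightarrow> ?u x = ?u (\<phi> p) + (\<Sum>b\<in>Basis. ((x - \<phi> p) \<bullet> b) * g b x)"
      "\<And>b. g b (\<phi> p) = frechet_derivative ?u (at (\<phi> p)) b"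
      using hadamard[OF chart_image_open[OF chart] CinfD[OF h chart] r'(2) p(2)] by blast
    define G where "G = (\<lambda>b. ext (g b))"
    \<comment> \<open>The cut-off of the b-th coordinate of x - \<phi> p. It vanishes at p, so the
      Leibniz rule reduces v (Z G) to G p * v Z, and the derivatives of the unknown G
      disappear.\<close>
    define Z where "Z = (\<lambda>b x. 1 * Y b x + - (\<phi> p \<bullet> b) * \<rho> x)"
    have G: "G b \<in> Cinf A" for b
      unfolding G_def by (intro ext_Cinf g(1))
    have Z: "Z b \<in> Cinf A" for b
      unfolding Z_def by (intro Cinf_add Cinf_cmult Y \<rho>)
    have Zp: "Z b p = 0" for b
      using p by (simp add: Z_def Y_def \<rho>_def ext_def)
    have vZ: "v (Z b) = v (Y b) - (\<phi> p \<bullet> b) * v \<rho>" for b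
      unfolding Z_def by (subst tangent_lincomb[OF v Y \<rho>]) simp
    have Gp: "G b p = \<rho> p * D h p b" for b
      using p by (simp add: G_def \<rho>_def ext_def g(3) D_def)
    have eq: "(\<lambda>q. \<rho> q * \<rho> q * h q) = (\<lambda>q. h p * (\<rho> q * \<rho> q) + (\<Sum>b\<in>Basis. Z b q * G b q))"
    proof
      fix q
      show "\<rho> q * \<rho> q * h q = h p * (\<rho> q * \<rho> q) + (\<Sum>b\<in>Basis. Z b q * G b q)"
      proof (cases "\<rho> q = 0")
        case True
        then have "G b q = 0" for b
          by (auto simp: G_def \<rho>_def ext_def split: if_splits)
        then show ?thesis using True by simp
      next
        case False
        then have q: "q \<in> U" "\<phi> q \<in> ball a r'" using \<rho>_ball by auto
        have "h q = h p + (\<Sum>b\<in>Basis. ((\<phi> q - \<phi> p) \<bullet> b) * g b (\<phi> q))"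
          using g(2)[OF q(2)] by (simp add: chart_inv[OF chart] p q)
        moreover have "Z b q * G b q = \<rho> q * \<rho> q * (((\<phi> q - \<phi> p) \<bullet> b) * g b (\<phi> q))" for b
          using q by (simp add: Z_def Y_def G_def \<rho>_def ext_def algebra_simps)
        ultimately show ?thesis
          by (simp only: sum_distrib_left[symmetric] distrib_left) (simp only: mult_ac)
      qed
    qed
    have \<rho>\<rho>: "(\<lambda>q. \<rho> q * \<rho> q) \<in> Cinf A"
      by (intro Cinf_mult \<rho>)
    have "v (\<lambda>q. \<rho> q * \<rho> q * h q) = \<rho> p * \<rho> p * v h + h p * v (\<lambda>q. \<rho> q * \<rho> q)"
      by (rule tangent_mult[OF v \<rho>\<rho> h])
    moreover have "v (\<lambda>q. \<Sum>b\<in>Basis. Z b q * G b q) =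
        (\<Sum>b\<in>Basis. \<rho> p * D h p b * (v (Y b) - (\<phi> p \<bullet> b) * v \<rho>))"
      by (subst tangent_sum[OF v])
        (auto intro!: Cinf_mult Z G simp: tangent_mult[OF v Z G] Zp Gp vZ)
    then have "v (\<lambda>q. h p * (\<rho> q * \<rho> q) + (\<Sum>b\<in>Basis. Z b q * G b q)) =
        h p * v (\<lambda>q. \<rho> q * \<rho> q) + (\<Sum>b\<in>Basis. \<rho> p * D h p b * (v (Y b) - (\<phi> p \<bullet> b) * v \<rho>))"
      by (subst tangent_add[OF v])
        (auto intro!: Cinf_cmult \<rho>\<rho> Cinf_sum Cinf_mult Z G simp: tangent_cmult[OF v \<rho>\<rho>])
    ultimately have "\<rho> p * \<rho> p * v h = (\<Sum>b\<in>Basis. \<rho> p * D h p b * (v (Y b) - (\<phi> p \<bullet> b) * v \<rho>))"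
      unfolding eq by simp
    then have "\<rho> p ^ 3 * v h = \<rho> p * (\<Sum>b\<in>Basis. \<rho> p * D h p b * (v (Y b) - (\<phi> p \<bullet> b) * v \<rho>))"
      by (simp add: power3_eq_cube)
    also have "\<dots> = (\<Sum>b\<in>Basis. (\<rho> p * v (Y b) - Y b p * v \<rho>) * E b p h)"
      unfolding sum_distrib_left
      using h p by (intro sum.cong) (auto simp: E_def Y_def \<rho>_def ext_def algebra_simps)
    finally show ?thesis .
  qed
  \<comment> \<open>The test function is the cut-off j-th coordinate centred at \<open>p0\<close>.
    Since the coordinate vanishes there, the derivative of the bump drops out and only the j-th
    coefficient survives.\<close>
  have indep: "\<forall>b\<in>Basis. c b = 0"
    if *: "\<And>h. h \<in> Cinf A \<Longrightarrow> (\<Sum>b\<in>Basis. c b * E b p0 h) = 0" for c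
  proof
    fix j :: 'e assume j: "j \<in> Basis"
    define w where "w = ext (\<lambda>x. (x - a) \<bullet> j)"
    have "Ck_on k (ball a r') (\<lambda>x. (x + - a) \<bullet> j)" for k
      by (intro Ck_on_linear_image[OF bounded_linear_inner_left] Ck_on_add Ck_on_const
          Ck_on_linear[OF bounded_linear_ident] open_ball)
    then have w: "w \<in> Cinf A"
      unfolding w_def by (intro ext_Cinf) simp
    have "(\<beta> has_derivative frechet_derivative \<beta> (at a)) (at a)"
      using Ck_on_has_derivative[OF Ck_on_bump[of "Suc 0" r a]] by (simp add: \<beta>_def)
    moreover have "((\<lambda>x. (x - a) \<bullet> j) has_derivative (\<lambda>v. v \<bullet> j)) (at a)"
      by (auto intro!: derivative_eq_intros)
    ultimately have "((\<lambda>x. \<beta> x * ((x - a) \<bullet> j)) has_derivative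
        (\<lambda>v. \<beta> a * (v \<bullet> j) + frechet_derivative \<beta> (at a) v * ((a - a) \<bullet> j))) (at a)"
      by (rule has_derivative_mult)
    then have "((\<lambda>x. \<beta> x * ((x - a) \<bullet> j)) has_derivative (\<lambda>v. \<beta> a * (v \<bullet> j))) (at a)"
      by simp
    moreover have "a \<in> \<phi> ` U"
      using p0 by (simp add: a_def)
    moreover have "\<beta> x * ((x - a) \<bullet> j) = w (inv_into U \<phi> x)" if "x \<in> \<phi> ` U" for x
      using that by (auto simp: w_def ext_def chart_inv[OF chart])
    ultimately have "((\<lambda>x. w (inv_into U \<phi> x)) has_derivative (\<lambda>v. \<beta> a * (v \<bullet> j))) (at a)"
      by (rule has_derivative_transform_within_open[OF _ chart_image_open[OF chart]])
    from frechet_derivative_at[OF this] have "D w p0 = (\<lambda>v. \<beta> a * (v \<bullet> j))"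
      by (simp add: D_def a_def)
    then have "(\<Sum>b\<in>Basis. c b * E b p0 w) = (\<Sum>b\<in>Basis. if b = j then c b * (\<rho> p0 * \<beta> a) else 0)"
      using w p0 j by (intro sum.cong) (auto simp: E_def inner_Basis)
    also have "\<dots> = c j * (\<rho> p0 * \<beta> a)"
      using j by simp
    finally show "c j = 0"
      using *[OF w] \<rho>0 p0 by (auto simp: \<rho>_def ext_def a_def)
  qed
  have E_eq: "E b p h = \<rho> p * frechet_derivative (\<lambda>x. h (inv_into U \<phi> x)) (at (\<phi> p)) b"
    if "h \<in> Cinf A" "p \<in> U" for b p h
    using that by (simp add: E_def D_def)
  show ?thesis
    using \<rho>_ball by (intro that[OF \<rho> \<rho>0 _ Y E deriv E_eq indep]) auto
qed

end

section \<open>Covariant derivatives in local frames\<close>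

locale riemannian = manifold A
  for A :: "('a::{t2_space,second_countable_topology}, 'e::euclidean_space) atlas" +
  fixes g :: "'a \<Rightarrow> 'a tvec \<Rightarrow> 'a tvec \<Rightarrow> real"
    and conn :: "'a vfield \<Rightarrow> 'a vfield \<Rightarrow> 'a vfield"
  assumes metric: "riemannian_metric A g" and connection: "affine_connection A conn"
begin

abbreviation "VF \<equiv> vector_fields A"
abbreviation "cov \<equiv> cov_deriv conn"

lemma zero_VF: "(\<lambda>p h. 0) \<in> VF"
  by (auto simp: vector_fields_def tangent_space_def Cinf_const)

lemma VF_sum:
  assumes "\<And>i. i \<in> I \<Longrightarrow> f i \<in> Cinf A" "\<And>i. i \<in> I \<Longrightarrow> X i \<in> VF"
  shows "(\<lambda>p h. \<Sum>i\<in>I. f i p * X i p h) \<in> VF"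
  using assms unfolding vector_fields_def
  by (auto intro!: tangent_space_sum Cinf_sum Cinf_mult)

lemma conn_VF: "X \<in> VF \<Longrightarrow> Y \<in> VF \<Longrightarrow> conn X Y \<in> VF"
  using connection by (simp add: affine_connection_def)

lemma conn_left:
  "\<lbrakk>X \<in> VF; Y \<in> VF; Z \<in> VF; f \<in> Cinf A; k \<in> Cinf A\<rbrakk> \<Longrightarrow>
    conn (vf_comb f X k Y) Z = vf_comb f (conn X Z) k (conn Y Z)"
  using connection by (simp add: affine_connection_def)

lemma conn_right:
  assumes X: "X \<in> VF" and Y: "Y \<in> VF" and Z: "Z \<in> VF" and f: "f \<in> Cinf A" and k: "k \<in> Cinf A"
  shows "conn X (vf_comb f Y k Z) =
    vf_comb (\<lambda>_. 1) (vf_comb f (conn X Y) (\<lambda>p. X p f) Y) (\<lambda>_. 1) (vf_comb k (conn X Z) (\<lambda>p. X p k) Z)"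
proof -
  have fY: "(\<lambda>p h. f p * Y p h) \<in> VF" and kZ: "(\<lambda>p h. k p * Z p h) \<in> VF"
    using vector_field_comb[OF Y Y f Cinf_const[of 0]] vector_field_comb[OF Z Z k Cinf_const[of 0]]
    by (simp_all add: vf_comb_def)
  have "conn X (vf_comb f Y k Z) =
      conn X (vf_comb (\<lambda>_. 1) (\<lambda>p h. f p * Y p h) (\<lambda>_. 1) (\<lambda>p h. k p * Z p h))"
    by (simp add: vf_comb_def)
  also have "\<dots> = vf_comb (\<lambda>_. 1) (conn X (\<lambda>p h. f p * Y p h)) (\<lambda>_. 1) (conn X (\<lambda>p h. k p * Z p h))"
    using connection X fY kZ by (simp add: affine_connection_def)
  finally show ?thesis
    using connection X Y Z f k by (simp add: affine_connection_def)
qed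

lemma set_list_update_VF: "set Xs \<subseteq> VF \<Longrightarrow> X \<in> VF \<Longrightarrow> set (Xs[l := X]) \<subseteq> VF"
  using set_update_subset_insert[of Xs l X] by blast

lemma set_update_conn_VF:
  "set Xs \<subseteq> VF \<Longrightarrow> X \<in> VF \<Longrightarrow> l < length Xs \<Longrightarrow> set (Xs[l := conn X (Xs ! l)]) \<subseteq> VF"
  by (rule set_list_update_VF) (auto intro!: conn_VF)

text \<open>The recursion of \<open>cov_deriv\<close> passes to shorter lists with altered entries,
  so the induction runs over the length of the list instead of its structure.\<close>

lemma cov_Cinf:
  assumes "h \<in> Cinf A" "set Xs \<subseteq> VF"
  shows "cov h Xs \<in> Cinf A"
  using assms(2)
proof (induction Xs rule: measure_induct_rule[of length])
  case (less Xs)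
  show ?case
  proof (cases Xs)
    case Nil
    then show ?thesis using assms(1) by simp
  next
    case (Cons X Ys)
    have X: "X \<in> VF" and Ys: "set Ys \<subseteq> VF"
      using less.prems Cons by auto
    have IH: "cov h Ws \<in> Cinf A" if "length Ws = length Ys" "set Ws \<subseteq> VF" for Ws
      using less.IH[of Ws] that Cons by simp
    have "cov h (Ys[l := conn X (Ys ! l)]) \<in> Cinf A" if "l \<in> {..<length Ys}" for l
      using that by (intro IH set_update_conn_VF Ys X) auto
    then show ?thesis
      unfolding Cons cov_deriv.simps
      by (rule Cinf_diff[OF vector_field_Cinf[OF X IH[OF refl Ys]] Cinf_sum])
  qed
qed

lemma cov_lincomb:
  assumes "h \<in> Cinf A" "k \<in> Cinf A" "set Xs \<subseteq> VF"
  shows "cov (\<lambda>x. a * h x + b * k x) Xs = (\<lambda>p. a * cov h Xs p + b * cov k Xs p)"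
  using assms(3)
proof (induction Xs rule: measure_induct_rule[of length])
  case (less Xs)
  show ?case
  proof (cases Xs)
    case (Cons X Ys)
    have X: "X \<in> VF" and Ys: "set Ys \<subseteq> VF"
      using less.prems Cons by auto
    have 1: "X p (cov (\<lambda>x. a * h x + b * k x) Ys) = a * X p (cov h Ys) + b * X p (cov k Ys)" for p
      using less.IH[of Ys] Ys Cons
      by (simp add: tangent_lincomb[OF vector_fieldD[OF X]] cov_Cinf assms)
    have 2: "cov (\<lambda>x. a * h x + b * k x) (Ys[l := conn X (Ys ! l)]) p =
        a * cov h (Ys[l := conn X (Ys ! l)]) p + b * cov k (Ys[l := conn X (Ys ! l)]) p"
      if "l < length Ys" for l p
      using less.IH[of "Ys[l := conn X (Ys ! l)]"] set_update_conn_VF[OF Ys X that] Cons by simp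
    show ?thesis
      by (rule ext) (simp add: Cons 1 2 sum.distrib sum_distrib_left algebra_simps)
  qed simp
qed

lemma cov_diff:
  assumes "h \<in> Cinf A" "k \<in> Cinf A" "set Xs \<subseteq> VF"
  shows "cov (\<lambda>x. h x - k x) Xs p = cov h Xs p - cov k Xs p"
  using cov_lincomb[OF assms, of 1 "-1"] by (simp add: fun_eq_iff)

text \<open>
  Multilinearity over the smooth functions: the Leibniz terms \<open>X f\<close> produced by the derivative
  of \<open>f T(\<dots>, Y, \<dots>)\<close> cancel against those of \<open>\<nabla>\<^sub>X (f Y)\<close>.
\<close>

lemma cov_slot:
  assumes h: "h \<in> Cinf A" and f: "f \<in> Cinf A" and k: "k \<in> Cinf A"
    and X: "X \<in> VF" and Y: "Y \<in> VF" and Xs: "set Xs \<subseteq> VF" and l: "l < length Xs"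
  shows "cov h (Xs[l := vf_comb f X k Y]) p = f p * cov h (Xs[l := X]) p + k p * cov h (Xs[l := Y]) p"
  using Xs l f k X Y
proof (induction Xs arbitrary: l f k X Y p rule: measure_induct_rule[of length])
  case (less Xs)
  note f = less.prems(3) and k = less.prems(4) and X = less.prems(5) and Y = less.prems(6)
  obtain Z Zs where Xs: "Xs = Z # Zs" using less.prems(2) by (cases Xs) auto
  have Z: "Z \<in> VF" and Zs: "set Zs \<subseteq> VF" using less.prems(1) Xs by auto
  have IH: "cov h (Ws[m := vf_comb f' X' k' Y']) q =
      f' q * cov h (Ws[m := X']) q + k' q * cov h (Ws[m := Y']) q"
    if "length Ws = length Zs" "set Ws \<subseteq> VF" "m < length Zs" "f' \<in> Cinf A" "k' \<in> Cinf A" "X' \<in> VF" "Y' \<in> VF"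
    for Ws m f' k' X' Y' q
    using less.IH[of Ws m f' k' X' Y' q] that Xs by simp
  show ?case
  proof (cases l)
    case 0
    \<comment> \<open>Slot 0 is the direction of differentiation. Applying a field and taking
      \<open>conn\<close> are both linear over functions in that argument, so no Leibniz terms
      arise.\<close>
    have "cov h (Zs[m := conn (vf_comb f X k Y) (Zs ! m)]) p =
        f p * cov h (Zs[m := conn X (Zs ! m)]) p + k p * cov h (Zs[m := conn Y (Zs ! m)]) p"
      if m: "m < length Zs" for m
    proof -
      have "Zs ! m \<in> VF" using Zs m by auto
      then show ?thesis
        using IH[OF _ Zs m f k, of "conn X (Zs ! m)" "conn Y (Zs ! m)"] X Y
        by (simp add: conn_left f k conn_VF)
    qed
    then have "(\<Sum>m<length Zs. cov h (Zs[m := conn (vf_comb f X k Y) (Zs ! m)]) p) =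
        f p * (\<Sum>m<length Zs. cov h (Zs[m := conn X (Zs ! m)]) p) +
        k p * (\<Sum>m<length Zs. cov h (Zs[m := conn Y (Zs ! m)]) p)"
      by (simp add: sum.distrib sum_distrib_left)
    moreover have "vf_comb f X k Y p u = f p * X p u + k p * Y p u" for u
      by (simp add: vf_comb_def)
    ultimately show ?thesis
      by (simp add: 0 Xs algebra_simps)
  next
    case (Suc l')
    have l': "l' < length Zs" using less.prems(2) Xs Suc by simp
    let ?W = "vf_comb f X k Y"
    let ?T = "\<lambda>X. cov h (Zs[l' := X])"
    let ?R = "\<lambda>X m. cov h (Zs[l' := X, m := conn Z (Zs[l' := X] ! m)]) p"
    \<comment> \<open>These are the Leibniz terms from Z differentiating the coefficients. The same
      expression reappears in the subtracted sum, in the summand m = l' only, where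
      \<open>conn Z\<close> meets the combination.\<close>
    let ?L = "Z p f * ?T X p + Z p k * ?T Y p"
    have TX: "?T X \<in> Cinf A" and TY: "?T Y \<in> Cinf A"
      by (rule cov_Cinf[OF h set_list_update_VF[OF Zs X]], rule cov_Cinf[OF h set_list_update_VF[OF Zs Y]])
    have "?T ?W = (\<lambda>q. f q * ?T X q + k q * ?T Y q)"
      by (rule ext) (rule IH[OF refl Zs l' f k X Y])
    then have 1: "Z p (?T ?W) = f p * Z p (?T X) + k p * Z p (?T Y) + ?L"
      using tangent_add[OF vector_fieldD[OF Z] Cinf_mult[OF f TX] Cinf_mult[OF k TY], of p]
        tangent_mult[OF vector_fieldD[OF Z] f TX, of p] tangent_mult[OF vector_fieldD[OF Z] k TY, of p]
      by simp
    have R: "?R ?W m = f p * ?R X m + k p * ?R Y m + (if m = l' then ?L else 0)"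
      if m: "m < length Zs" for m
    proof (cases "m = l'")
      case True
      have "?R ?W m = ?T (conn Z ?W) p"
        using True l' by simp
      also have "\<dots> = ?T (vf_comb f (conn Z X) (\<lambda>p. Z p f) X) p + ?T (vf_comb k (conn Z Y) (\<lambda>p. Z p k) Y) p"
        unfolding conn_right[OF Z X Y f k]
        by (subst IH[OF refl Zs l' Cinf_const Cinf_const])
          (auto intro!: vector_field_comb conn_VF vector_field_Cinf[OF Z f] vector_field_Cinf[OF Z k] f k X Y Z)
      also have "?T (vf_comb f (conn Z X) (\<lambda>p. Z p f) X) p = f p * ?T (conn Z X) p + Z p f * ?T X p"
        by (rule IH[OF refl Zs l' f vector_field_Cinf[OF Z f] conn_VF[OF Z X] X])
      also have "?T (vf_comb k (conn Z Y) (\<lambda>p. Z p k) Y) p = k p * ?T (conn Z Y) p + Z p k * ?T Y p"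
        by (rule IH[OF refl Zs l' k vector_field_Cinf[OF Z k] conn_VF[OF Z Y] Y])
      finally show ?thesis
        using True l' by simp
    next
      case False
      have "set (Zs[m := conn Z (Zs ! m)]) \<subseteq> VF"
        by (rule set_update_conn_VF[OF Zs Z m])
      then show ?thesis
        using False IH[OF _ _ l' f k X Y, of "Zs[m := conn Z (Zs ! m)]"]
        by (simp add: list_update_swap[of l' m])
    qed
    have "cov h (Xs[l := ?W]) p = Z p (?T ?W) - (\<Sum>m<length Zs. ?R ?W m)"
      by (simp add: Xs Suc)
    also have "(\<Sum>m<length Zs. ?R ?W m) =
        f p * (\<Sum>m<length Zs. ?R X m) + k p * (\<Sum>m<length Zs. ?R Y m) + ?L"
      using l' by (simp add: R sum.distrib sum_distrib_left[symmetric] sum.delta)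
    finally show ?thesis
      unfolding 1 by (simp add: Xs Suc algebra_simps)
  qed
qed

lemma cov_slot_sum:
  assumes h: "h \<in> Cinf A" and Xs: "set Xs \<subseteq> VF" and l: "l < length Xs"
    and f: "\<And>b. f b \<in> Cinf A" and E: "\<And>b. E b \<in> VF"
  shows "cov h (Xs[l := (\<lambda>p h. \<Sum>b\<in>B. f b p * E b p h)]) p = (\<Sum>b\<in>B. f b p * cov h (Xs[l := E b]) p)"
proof -
  have 0: "cov h (Xs[l := (\<lambda>p h. 0)]) p = 0"
    using cov_slot[OF h Cinf_const[of 0] Cinf_const[of 0] zero_VF zero_VF Xs l, of p]
    by (simp add: vf_comb_def)
  show ?thesis
  proof (induction B rule: infinite_finite_induct)
    case (insert b B)
    have "(\<lambda>p h. \<Sum>b\<in>insert b B. f b p * E b p h) =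
        vf_comb (f b) (E b) (\<lambda>_. 1) (\<lambda>p h. \<Sum>b\<in>B. f b p * E b p h)"
      using insert.hyps by (simp add: vf_comb_def)
    then show ?case
      using insert cov_slot[OF h f[of b] Cinf_const[of 1] E[of b] VF_sum[of B f E] Xs l, of p] f E
      by simp
  qed (auto simp: 0)
qed

section \<open>Controlling all unit tuples by finitely many frame tuples\<close>

lemma metric_lincomb:
  assumes "v \<in> tangent_space A p" "w \<in> tangent_space A p" "z \<in> tangent_space A p"
  shows "g p (\<lambda>h. a * v h + b * w h) z = a * g p v z + b * g p w z"
  using metric assms by (simp add: riemannian_metric_def)

lemma metric_sym:
  "v \<in> tangent_space A p \<Longrightarrow> w \<in> tangent_space A p \<Longrightarrow> g p v w = g p w v"
  using metric by (simp add: riemannian_metric_def)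

lemma metric_sum:
  assumes "\<And>i. i \<in> I \<Longrightarrow> v i \<in> tangent_space A p" "z \<in> tangent_space A p"
  shows "g p (\<lambda>h. \<Sum>i\<in>I. c i * v i h) z = (\<Sum>i\<in>I. c i * g p (v i) z)"
proof -
  have 0: "g p (\<lambda>h. 0) z = 0"
    using metric_lincomb[OF assms(2) assms(2) assms(2), of 0 0] by simp
  show ?thesis
    using assms(1)
  proof (induction I rule: infinite_finite_induct)
    case (insert i I)
    then show ?case
      using metric_lincomb[of "v i" p "\<lambda>h. \<Sum>i\<in>I. c i * v i h" z "c i" 1]
        tangent_space_sum[of I v p c] assms(2) by simp
  qed (auto simp: 0)
qed

text \<open>
  Coefficients of unit vectors in a frame are bounded, since the least eigenvalue of the Gram
  matrix is bounded below near \<open>p\<^sub>0\<close>.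
\<close>

lemma local_bound:
  obtains N E c where "open N" "p0 \<in> N" "\<And>b. E b \<in> VF" "c \<ge> 0"
    and "\<And>p X. p \<in> N \<Longrightarrow> X \<in> VF \<Longrightarrow> g p (X p) (X p) \<le> 1 \<Longrightarrow>
      \<exists>\<gamma>. (\<forall>b. b \<in> Basis \<longrightarrow> \<bar>\<gamma> b\<bar> \<le> c) \<and> (\<forall>h Xs l. h \<in> Cinf A \<longrightarrow> set Xs \<subseteq> VF \<longrightarrow> l < length Xs \<longrightarrow>
        cov h (Xs[l := X]) p = (\<Sum>b\<in>(Basis::'e set). \<gamma> b * cov h (Xs[l := E b]) p))"
proof -
  obtain U \<phi> where U: "(U, \<phi>) \<in> A" "p0 \<in> U" using chart_cover by blast
  show ?thesis
  proof (rule frame[OF U])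
    fix \<rho> :: "'a \<Rightarrow> real" and Y :: "'e \<Rightarrow> 'a \<Rightarrow> real" and E :: "'e \<Rightarrow> 'a vfield"
    assume \<rho>: "\<rho> \<in> Cinf A" "\<rho> p0 \<noteq> 0" and Y: "\<And>b. Y b \<in> Cinf A" and E: "\<And>b. E b \<in> VF"
      and deriv: "\<And>p v h. v \<in> tangent_space A p \<Longrightarrow>
            \<rho> p ^ 3 * v h = (\<Sum>b\<in>Basis. (\<rho> p * v (Y b) - Y b p * v \<rho>) * E b p h)"
      and indep: "\<And>c. (\<And>h. h \<in> Cinf A \<Longrightarrow> (\<Sum>b\<in>Basis. c b * E b p0 h) = 0) \<Longrightarrow> \<forall>b\<in>Basis. c b = 0"
    have ET: "E b p \<in> tangent_space A p" for b p
      by (rule vector_fieldD[OF E])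
    \<comment> \<open>The quadratic form of the Gram matrix, as a function of the point and the
      coordinate vector together, so that compactness of the sphere yields a neighbourhood
      \<open>X0\<close> that works for all unit c.\<close>
    define Q where "Q = (\<lambda>(p, c). \<Sum>b\<in>Basis. \<Sum>b'\<in>Basis. (c \<bullet> b) * (c \<bullet> b') * g p (E b p) (E b' p))"
    have Q_eq: "Q (p, c) = g p (\<lambda>h. \<Sum>b\<in>Basis. (c \<bullet> b) * E b p h) (\<lambda>h. \<Sum>b\<in>Basis. (c \<bullet> b) * E b p h)"
      (is "_ = g p ?w ?w") for p c
    proof -
      have w: "?w \<in> tangent_space A p"
        by (intro tangent_space_sum ET)
      have "g p ?w ?w = (\<Sum>b\<in>Basis. (c \<bullet> b) * g p (E b p) ?w)"
        by (intro metric_sum ET w)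
      also have "\<dots> = (\<Sum>b\<in>Basis. (c \<bullet> b) * (\<Sum>b'\<in>Basis. (c \<bullet> b') * g p (E b' p) (E b p)))"
        by (intro sum.cong refl arg_cong2[where f = "(*)"]) (simp add: metric_sym[OF ET w] metric_sum[OF ET ET])
      finally show ?thesis
        by (simp add: Q_def sum_distrib_left metric_sym[OF ET ET] mult_ac)
    qed
    have gE: "(\<lambda>p. g p (E b p) (E b' p)) \<in> Cinf A" for b b'
      using metric E by (simp add: riemannian_metric_def)
    have Q_cont: "continuous_on UNIV Q"
      unfolding Q_def case_prod_unfold
      by (intro continuous_intros continuous_on_compose2[OF Cinf_continuous[OF gE] continuous_on_fst]) auto
    let ?S = "sphere (0::'e) 1"
    have "continuous_on ?S (\<lambda>c. Q (p0, c))"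
      by (rule continuous_on_compose2[OF Q_cont]) (auto intro!: continuous_intros)
    moreover have "?S \<noteq> {}" by simp
    ultimately obtain c0 where c0: "c0 \<in> ?S" "\<And>c. c \<in> ?S \<Longrightarrow> Q (p0, c0) \<le> Q (p0, c)"
      using continuous_attains_inf[OF compact_sphere] by blast
    \<comment> \<open>Half of the minimum over the unit sphere at \<open>p0\<close>; the other half
      is given up when p moves within \<open>X0\<close>.\<close>
    define m where "m = Q (p0, c0) / 2"
    have m: "m > 0"
    proof -
      let ?w = "\<lambda>h. \<Sum>b\<in>Basis. (c0 \<bullet> b) * E b p0 h"
      have "?w \<noteq> (\<lambda>h. 0)"
      proof
        assume "?w = (\<lambda>h. 0)"
        then have "\<forall>b\<in>Basis. c0 \<bullet> b = 0"
          by (intro indep) (simp add: fun_eq_iff)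
        then have "c0 = 0"
          by (simp add: euclidean_all_zero_iff)
        then show False
          using c0(1) by simp
      qed
      moreover have "?w \<in> tangent_space A p0"
        by (intro tangent_space_sum ET)
      ultimately show ?thesis
        using metric by (simp add: riemannian_metric_def m_def Q_eq)
    qed
    obtain X0 where X0: "p0 \<in> X0" "open X0"
      "\<And>p c. p \<in> X0 \<Longrightarrow> c \<in> ?S \<Longrightarrow> dist (Q (p, c)) (Q (p0, c)) \<le> m"
      by (rule continuous_on_prod_compactE[OF continuous_on_subset[OF Q_cont subset_UNIV] compact_sphere UNIV_I m,
            of p0]) blast
    have Q_ge: "m * (norm c)\<^sup>2 \<le> Q (p, c)" if p: "p \<in> X0" for p c
    proof (cases "c = 0")
      case True
      then show ?thesis by (simp add: Q_def)
    next
      case False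
      define s where "s = c /\<^sub>R norm c"
      have s: "s \<in> ?S" and c: "c = norm c *\<^sub>R s"
        using False by (simp_all add: s_def)
      have "m \<le> Q (p, s)"
        using X0(3)[OF p s] c0(2)[OF s] unfolding dist_real_def m_def by linarith
      moreover have "Q (p, c) = (norm c)\<^sup>2 * Q (p, s)"
        by (subst c) (simp add: Q_def sum_distrib_left power2_eq_square mult_ac)
      ultimately show ?thesis
        by (simp add: mult.commute[of m] mult_left_mono)
    qed
    define N where "N = X0 \<inter> {p. \<rho> p \<noteq> 0}"
    have "open {p. \<rho> p \<noteq> 0}"
      using Cinf_continuous[OF \<rho>(1)] by (simp add: open_Collect_neq)
    then have N: "open N" "p0 \<in> N"
      using X0 \<rho>(2) by (auto simp: N_def)
    show ?thesis
    proof (rule that[OF N E])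
      show "sqrt (1 / m) \<ge> 0" using m by simp
      fix p X assume p: "p \<in> N" and X: "X \<in> VF" and unit: "g p (X p) (X p) \<le> 1"
      have \<rho>p: "\<rho> p \<noteq> 0" and pX0: "p \<in> X0"
        using p by (auto simp: N_def)
      define f where "f = (\<lambda>b q. \<rho> q * X q (Y b) - Y b q * X q \<rho>)"
      define \<gamma> where "\<gamma> = (\<lambda>b. f b p / \<rho> p ^ 3)"
      have f: "f b \<in> Cinf A" for b
        unfolding f_def
        by (intro Cinf_diff Cinf_mult vector_field_Cinf[OF X \<rho>(1)] vector_field_Cinf[OF X Y] Y \<rho>(1))
      have \<rho>3: "(\<lambda>q. \<rho> q ^ 3) \<in> Cinf A"
        unfolding power3_eq_cube by (intro Cinf_mult \<rho>(1))
      \<comment> \<open>\<open>cov_slot\<close> speaks of fields, not of values at one point. The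
        frame expansion must therefore be an identity of global fields, with \<rho>^3 kept on the
        left; dividing by its value at p comes last.\<close>
      have field_eq: "vf_comb (\<lambda>q. \<rho> q ^ 3) X (\<lambda>_. 0) X = (\<lambda>q h. \<Sum>b\<in>Basis. f b q * E b q h)"
        using deriv[OF vector_fieldD[OF X]] by (simp add: vf_comb_def f_def)
      have Xp: "X p = (\<lambda>h. \<Sum>b\<in>Basis. \<gamma> b * E b p h)"
      proof
        fix h
        have "\<rho> p ^ 3 * X p h = \<rho> p ^ 3 * (\<Sum>b\<in>Basis. \<gamma> b * E b p h)"
          using deriv[OF vector_fieldD[OF X], of p h] \<rho>p by (simp add: \<gamma>_def f_def sum_distrib_left)
        then show "X p h = (\<Sum>b\<in>Basis. \<gamma> b * E b p h)"
          using \<rho>p by simp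
      qed
      define c where "c = (\<Sum>b\<in>Basis. \<gamma> b *\<^sub>R b)"
      have c: "c \<bullet> b = \<gamma> b" if "b \<in> Basis" for b
        using that by (simp add: c_def)
      have "Q (p, c) = g p (X p) (X p)"
        unfolding Q_eq Xp using c by simp
      then have "m * (norm c)\<^sup>2 \<le> 1"
        using Q_ge[OF pX0, of c] unit by simp
      then have "(norm c)\<^sup>2 \<le> 1 / m"
        using m by (simp add: field_simps)
      then have "norm c \<le> sqrt (1 / m)"
        by (rule real_le_rsqrt)
      then have \<gamma>: "\<bar>\<gamma> b\<bar> \<le> sqrt (1 / m)" if "b \<in> Basis" for b
        using Basis_le_norm[OF that, of c] c[OF that] by simp
      have "cov h (Xs[l := X]) p = (\<Sum>b\<in>Basis. \<gamma> b * cov h (Xs[l := E b]) p)"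
        if h: "h \<in> Cinf A" and Xs: "set Xs \<subseteq> VF" and l: "l < length Xs" for h Xs l
      proof -
        have "\<rho> p ^ 3 * cov h (Xs[l := X]) p = cov h (Xs[l := vf_comb (\<lambda>q. \<rho> q ^ 3) X (\<lambda>_. 0) X]) p"
          using cov_slot[OF h \<rho>3 Cinf_const[of 0] X X Xs l, of p] by simp
        also have "\<dots> = (\<Sum>b\<in>Basis. f b p * cov h (Xs[l := E b]) p)"
          unfolding field_eq by (rule cov_slot_sum[OF h Xs l f E])
        also have "\<dots> = \<rho> p ^ 3 * (\<Sum>b\<in>Basis. \<gamma> b * cov h (Xs[l := E b]) p)"
          using \<rho>p by (simp add: \<gamma>_def sum_distrib_left)
        finally show ?thesis
          using \<rho>p by simp
      qed
      then show "\<exists>\<gamma>. (\<forall>b. b \<in> Basis \<longrightarrow> \<bar>\<gamma> b\<bar> \<le> sqrt (1 / m)) \<and>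
        (\<forall>h Xs l. h \<in> Cinf A \<longrightarrow> set Xs \<subseteq> VF \<longrightarrow> l < length Xs \<longrightarrow>
          cov h (Xs[l := X]) p = (\<Sum>b\<in>(Basis::'e set). \<gamma> b * cov h (Xs[l := E b]) p))"
        using \<gamma> by blast
    qed
  qed
qed

definition unit_fields :: "'a \<Rightarrow> nat \<Rightarrow> 'a vfield list set" where
  "unit_fields p j = {Xs. length Xs = j \<and> (\<forall>X\<in>set Xs. X \<in> VF \<and> g p (X p) (X p) \<le> 1)}"

text \<open>Slots are expanded in the frame one by one, each costing the dimension times the
  coefficient bound. The family and the constant are chosen before h, so they apply to differences
  and pullbacks as well.\<close>

lemma local_cov_bound:
  obtains N \<E> C where "open N" "p0 \<in> N" "finite \<E>" "\<And>Es. Es \<in> \<E> \<Longrightarrow> set Es \<subseteq> VF" "C \<ge> 0"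
    and "\<And>p h Xs M. p \<in> N \<Longrightarrow> h \<in> Cinf A \<Longrightarrow> Xs \<in> unit_fields p j \<Longrightarrow> 0 \<le> M \<Longrightarrow>
      (\<And>Es. Es \<in> \<E> \<Longrightarrow> \<bar>cov h Es p\<bar> \<le> M) \<Longrightarrow> \<bar>cov h Xs p\<bar> \<le> C * M"
proof -
  show ?thesis
  proof (rule local_bound[of p0])
    fix N and E :: "'e \<Rightarrow> 'a vfield" and c
    assume N: "open N" "p0 \<in> N" and E: "\<And>b. E b \<in> VF" and c: "c \<ge> 0"
      and exp: "\<And>p X. p \<in> N \<Longrightarrow> X \<in> VF \<Longrightarrow> g p (X p) (X p) \<le> 1 \<Longrightarrow>
        \<exists>\<gamma>. (\<forall>b. b \<in> Basis \<longrightarrow> \<bar>\<gamma> b\<bar> \<le> c) \<and> (\<forall>h Xs l. h \<in> Cinf A \<longrightarrow> set Xs \<subseteq> VF \<longrightarrow> l < length Xs \<longrightarrow>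
          cov h (Xs[l := X]) p = (\<Sum>b\<in>(Basis::'e set). \<gamma> b * cov h (Xs[l := E b]) p))"
    define D where "D = c * DIM('e)"
    have D: "D \<ge> 0" using c by (simp add: D_def)
    \<comment> \<open>\<open>Ys\<close> collects the slots that have already been replaced by frame
      fields.\<close>
    have step: "\<bar>cov h (Ys @ Xs) p\<bar> \<le> D ^ length Xs * M"
      if p: "p \<in> N" and h: "h \<in> Cinf A" and M: "0 \<le> M" and Xs: "Xs \<in> unit_fields p (length Xs)"
        and Ys: "set Ys \<subseteq> VF"
        and bound: "\<And>bs. set bs \<subseteq> Basis \<Longrightarrow> length bs = length Xs \<Longrightarrow> \<bar>cov h (Ys @ map E bs) p\<bar> \<le> M"
      for p h M Xs Ys
      using Xs Ys bound
    proof (induction Xs arbitrary: Ys)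
      case Nil
      then show ?case using Nil.prems(3)[of "[]"] by simp
    next
      case (Cons X Xs)
      have X: "X \<in> VF" "g p (X p) (X p) \<le> 1" and Xs: "Xs \<in> unit_fields p (length Xs)" "set Xs \<subseteq> VF"
        using Cons.prems(1) by (auto simp: unit_fields_def)
      obtain \<gamma> where \<gamma>: "\<And>b. b \<in> Basis \<Longrightarrow> \<bar>\<gamma> b\<bar> \<le> c"
        "\<And>Xs l. set Xs \<subseteq> VF \<Longrightarrow> l < length Xs \<Longrightarrow>
          cov h (Xs[l := X]) p = (\<Sum>b\<in>(Basis::'e set). \<gamma> b * cov h (Xs[l := E b]) p)"
        using exp[OF p X] h by blast
      have "cov h (Ys @ X # Xs) p = (\<Sum>b\<in>Basis. \<gamma> b * cov h (Ys @ E b # Xs) p)"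
        using \<gamma>(2)[of "Ys @ X # Xs" "length Ys"] Cons.prems(2) X(1) Xs(2) by simp
      also have "\<bar>\<dots>\<bar> \<le> (\<Sum>b\<in>(Basis::'e set). c * (D ^ length Xs * M))"
      proof (rule order_trans[OF sum_abs sum_mono])
        fix b :: 'e assume b: "b \<in> Basis"
        have "\<bar>cov h ((Ys @ [E b]) @ Xs) p\<bar> \<le> D ^ length Xs * M"
        proof (rule Cons.IH[OF Xs(1)])
          fix bs :: "'e list" assume "set bs \<subseteq> Basis" "length bs = length Xs"
          then show "\<bar>cov h ((Ys @ [E b]) @ map E bs) p\<bar> \<le> M"
            using Cons.prems(3)[of "b # bs"] b by simp
        qed (use Cons.prems(2) E in auto)
        then show "\<bar>\<gamma> b * cov h (Ys @ E b # Xs) p\<bar> \<le> c * (D ^ length Xs * M)"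
          unfolding abs_mult using \<gamma>(1)[OF b] c by (intro mult_mono) auto
      qed
      finally show ?case
        by (simp add: D_def mult_ac)
    qed
    define \<E> where "\<E> = map E ` {bs. set bs \<subseteq> Basis \<and> length bs = j}"
    show ?thesis
    proof (rule that[OF N, of \<E> "D ^ j"])
      show "finite \<E>"
        unfolding \<E>_def by (intro finite_imageI finite_lists_length_eq) simp
      show "set Es \<subseteq> VF" if "Es \<in> \<E>" for Es
        using that E by (auto simp: \<E>_def)
      show "D ^ j \<ge> 0" using D by simp
      fix p h Xs M
      assume *: "p \<in> N" "h \<in> Cinf A" "Xs \<in> unit_fields p j" "0 \<le> M"
        "\<And>Es. Es \<in> \<E> \<Longrightarrow> \<bar>cov h Es p\<bar> \<le> M"
      have len: "length Xs = j" using *(3) by (simp add: unit_fields_def)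
      then show "\<bar>cov h Xs p\<bar> \<le> D ^ j * M"
        using step[OF *(1,2,4), of Xs "[]"] *(3,5) by (auto simp: \<E>_def)
    qed
  qed
qed

text \<open>A finite subcover by the neighbourhoods of \<open>local_cov_bound\<close>: the families
  are united, and the sum of the nonnegative constants dominates each of them.\<close>

lemma compact_cov_bound:
  assumes "compact K"
  obtains \<E> C where "finite \<E>" "\<And>Es. Es \<in> \<E> \<Longrightarrow> set Es \<subseteq> VF" "C \<ge> 0"
    and "\<And>p h Xs M. p \<in> K \<Longrightarrow> h \<in> Cinf A \<Longrightarrow> Xs \<in> unit_fields p j \<Longrightarrow> 0 \<le> M \<Longrightarrow>
      (\<And>Es. Es \<in> \<E> \<Longrightarrow> \<bar>cov h Es p\<bar> \<le> M) \<Longrightarrow> \<bar>cov h Xs p\<bar> \<le> C * M"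
proof -
  define good where "good = (\<lambda>N \<E> C. finite \<E> \<and> (\<forall>Es\<in>\<E>. set Es \<subseteq> VF) \<and> C \<ge> 0 \<and>
    (\<forall>p\<in>N. \<forall>h\<in>Cinf A. \<forall>Xs\<in>unit_fields p j. \<forall>M\<ge>0.
      (\<forall>Es\<in>\<E>. \<bar>cov h Es p\<bar> \<le> M) \<longrightarrow> \<bar>cov h Xs p\<bar> \<le> C * M))"
  have "\<exists>N \<E> C. open N \<and> q \<in> N \<and> good N \<E> C" for q
  proof (rule local_cov_bound[of q j])
    fix N \<E> C
    assume "open N" "q \<in> N" and *: "finite \<E>" "\<And>Es. Es \<in> \<E> \<Longrightarrow> set Es \<subseteq> VF" "C \<ge> 0"
      "\<And>p h Xs M. p \<in> N \<Longrightarrow> h \<in> Cinf A \<Longrightarrow> Xs \<in> unit_fields p j \<Longrightarrow> 0 \<le> M \<Longrightarrow>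
        (\<And>Es. Es \<in> \<E> \<Longrightarrow> \<bar>cov h Es p\<bar> \<le> M) \<Longrightarrow> \<bar>cov h Xs p\<bar> \<le> C * M"
    have "good N \<E> C"
      unfolding good_def
    proof (intro conjI ballI allI impI *(1,3))
      show "set Es \<subseteq> VF" if "Es \<in> \<E>" for Es by (rule *(2)[OF that])
      show "\<bar>cov h Xs p\<bar> \<le> C * M" if "p \<in> N" "h \<in> Cinf A" "Xs \<in> unit_fields p j" "0 \<le> M"
        "\<forall>Es\<in>\<E>. \<bar>cov h Es p\<bar> \<le> M" for p h Xs M
        using *(4)[OF that(1-4)] that(5) by blast
    qed
    then show ?thesis
      using \<open>open N\<close> \<open>q \<in> N\<close> by blast
  qed
  then obtain N \<E> C where N: "\<And>q. open (N q)" "\<And>q. q \<in> N q" and good: "\<And>q. good (N q) (\<E> q) (C q)"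
    by metis
  have "K \<subseteq> (\<Union>q\<in>UNIV. N q)" using N(2) by auto
  then obtain I where I: "finite I" "K \<subseteq> (\<Union>q\<in>I. N q)"
    by (rule compactE_image[OF assms N(1)])
  have C: "C q \<ge> 0" for q using good by (simp add: good_def)
  show ?thesis
  proof (rule that[of "\<Union>q\<in>I. \<E> q" "\<Sum>q\<in>I. C q"])
    show "finite (\<Union>q\<in>I. \<E> q)" using I(1) good by (auto simp: good_def)
    show "set Es \<subseteq> VF" if "Es \<in> (\<Union>q\<in>I. \<E> q)" for Es
      using that good unfolding good_def by blast
    show "(\<Sum>q\<in>I. C q) \<ge> 0" by (intro sum_nonneg C)
    fix p h Xs M
    assume *: "p \<in> K" "h \<in> Cinf A" "Xs \<in> unit_fields p j" "0 \<le> (M::real)"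
      "\<And>Es. Es \<in> (\<Union>q\<in>I. \<E> q) \<Longrightarrow> \<bar>cov h Es p\<bar> \<le> M"
    obtain q where q: "q \<in> I" "p \<in> N q" using I *(1) by blast
    have "\<bar>cov h Xs p\<bar> \<le> C q * M"
      using good[of q] q * unfolding good_def by blast
    also have "\<dots> \<le> (\<Sum>q\<in>I. C q) * M"
      using q(1) I(1) C *(4) by (intro mult_right_mono member_le_sum) auto
    finally show "\<bar>cov h Xs p\<bar> \<le> (\<Sum>q\<in>I. C q) * M" .
  qed
qed

end

section \<open>The seminorms and the topology they generate\<close>

locale exhausted_manifold = riemannian A g conn
  for A :: "('a::{t2_space,second_countable_topology}, 'e::euclidean_space) atlas"
    and g :: "'a \<Rightarrow> 'a tvec \<Rightarrow> 'a tvec \<Rightarrow> real"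
    and conn :: "'a vfield \<Rightarrow> 'a vfield \<Rightarrow> 'a vfield" +
  fixes V :: "nat \<Rightarrow> 'a set"
  assumes exhaustion: "exhaustion V"
begin

abbreviation "K i \<equiv> closure (V i)"
abbreviation "sn \<equiv> cinf_seminorm A g conn V"
abbreviation "\<T> \<equiv> cinf_topology A g conn V"

lemma compact_K: "compact (K i)"
  using exhaustion by (simp add: exhaustion_def)

lemma compact_subset_K:
  assumes "compact L"
  obtains i where "L \<subseteq> K i"
proof -
  have mono: "V i \<subseteq> V k" if "i \<le> k" for i k
  proof (rule lift_Suc_mono_le[of V, OF _ that])
    show "V n \<subseteq> V (Suc n)" for n
      using exhaustion closure_subset[of "V n"] unfolding exhaustion_def by blast
  qed
  have "L \<subseteq> (\<Union>i\<in>UNIV. V i)" "\<And>i. open (V i)"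
    using exhaustion by (auto simp: exhaustion_def)
  then obtain I where I: "finite I" "L \<subseteq> (\<Union>i\<in>I. V i)"
    using compactE_image[OF assms, of UNIV V] by metis
  have "V i \<subseteq> V (Max (insert 0 I))" if "i \<in> I" for i
    using that I(1) by (intro mono) simp
  then have "L \<subseteq> V (Max (insert 0 I))"
    using I(2) by blast
  then show ?thesis
    using that closure_subset by blast
qed

text \<open>The zero field always has length at most 1. This keeps the supremum in
  \<open>cov_deriv_norm\<close> from being taken over the empty set.\<close>

lemma unit_fields_nonempty: "unit_fields p j \<noteq> {}"
proof -
  have "(\<lambda>h. 0) \<in> tangent_space A p"
    using vector_fieldD[OF zero_VF, of p] by simp
  then have "g p (\<lambda>h. 0) (\<lambda>h. 0) = 0"
    using metric_sum[of "{}" _ p "\<lambda>h. 0"] by simp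
  then have "replicate j (\<lambda>p h. 0) \<in> unit_fields p j"
    by (simp add: unit_fields_def zero_VF)
  then show ?thesis by blast
qed

lemma cov_deriv_norm_eq:
  "cov_deriv_norm A g conn j h p = Sup ((\<lambda>Xs. \<bar>cov h Xs p\<bar>) ` unit_fields p j)"
  unfolding cov_deriv_norm_def unit_fields_def by (rule arg_cong[where f = Sup]) blast

lemma seminorm_le:
  assumes "0 \<le> B" "\<And>p Xs. p \<in> K i \<Longrightarrow> Xs \<in> unit_fields p j \<Longrightarrow> \<bar>cov h Xs p\<bar> \<le> B"
  shows "sn i j h \<le> B"
  unfolding cinf_seminorm_def
proof (rule cSup_least)
  fix x assume "x \<in> insert 0 (cov_deriv_norm A g conn j h ` K i)"
  then show "x \<le> B"
    using assms unit_fields_nonempty by (auto simp: cov_deriv_norm_eq intro!: cSUP_least)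
qed simp

text \<open>Finitely many frame components are continuous, hence bounded on the compact set. This
  makes the suprema in the seminorms genuine upper bounds.\<close>

lemma cov_bounded:
  assumes h: "h \<in> Cinf A" and L: "compact L"
  shows "\<exists>B. \<forall>p\<in>L. \<forall>Xs\<in>unit_fields p j. \<bar>cov h Xs p\<bar> \<le> B"
proof (rule compact_cov_bound[OF L, of j])
  fix \<E> C
  assume \<E>: "finite \<E>" "\<And>Es. Es \<in> \<E> \<Longrightarrow> set Es \<subseteq> VF"
    and C: "\<And>p h Xs M. p \<in> L \<Longrightarrow> h \<in> Cinf A \<Longrightarrow> Xs \<in> unit_fields p j \<Longrightarrow> 0 \<le> M \<Longrightarrow>
      (\<And>Es. Es \<in> \<E> \<Longrightarrow> \<bar>cov h Es p\<bar> \<le> M) \<Longrightarrow> \<bar>cov h Xs p\<bar> \<le> C * M"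
  have "bounded (\<Union>Es\<in>\<E>. cov h Es ` L)"
  proof (intro bounded_UN \<E>(1) ballI compact_imp_bounded)
    fix Es assume "Es \<in> \<E>"
    then show "compact (cov h Es ` L)"
      using continuous_on_subset[OF Cinf_continuous[OF cov_Cinf[OF h \<E>(2)]] subset_UNIV] L
      by (intro compact_continuous_image) auto
  qed
  then obtain M where M: "M > 0" "\<And>Es p. Es \<in> \<E> \<Longrightarrow> p \<in> L \<Longrightarrow> \<bar>cov h Es p\<bar> \<le> M"
    unfolding bounded_pos by auto
  show ?thesis
    by (intro exI[of _ "C * M"]) (use C[OF _ h] M in auto)
qed

lemma cov_le_norm:
  assumes "h \<in> Cinf A" "Xs \<in> unit_fields p j"
  shows "\<bar>cov h Xs p\<bar> \<le> cov_deriv_norm A g conn j h p"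
proof -
  obtain B where "\<And>Xs. Xs \<in> unit_fields p j \<Longrightarrow> \<bar>cov h Xs p\<bar> \<le> B"
    using cov_bounded[OF assms(1), of "{p}" j] by auto
  then show ?thesis
    unfolding cov_deriv_norm_eq using assms(2)
    by (intro cSUP_upper) (auto simp: bdd_above_def)
qed

lemma seminorm_bdd:
  assumes "h \<in> Cinf A"
  shows "bdd_above (insert 0 (cov_deriv_norm A g conn j h ` K i))"
proof -
  obtain B where B: "\<And>p Xs. p \<in> K i \<Longrightarrow> Xs \<in> unit_fields p j \<Longrightarrow> \<bar>cov h Xs p\<bar> \<le> B"
    using cov_bounded[OF assms compact_K, of i j] by blast
  have "cov_deriv_norm A g conn j h p \<le> B" if "p \<in> K i" for p
    unfolding cov_deriv_norm_eq using B[OF that] unit_fields_nonempty by (intro cSUP_least)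
  then show ?thesis
    by (auto intro!: bdd_aboveI[of _ B] simp del: insert_iff)
qed

lemma cov_le_seminorm:
  assumes "h \<in> Cinf A" "p \<in> K i" "Xs \<in> unit_fields p j"
  shows "\<bar>cov h Xs p\<bar> \<le> sn i j h"
proof -
  have "cov_deriv_norm A g conn j h p \<le> sn i j h"
    unfolding cinf_seminorm_def using assms(2) by (intro cSup_upper seminorm_bdd[OF assms(1)]) simp
  then show ?thesis
    using cov_le_norm[OF assms(1,3)] by simp
qed

lemma seminorm_nonneg: "h \<in> Cinf A \<Longrightarrow> 0 \<le> sn i j h"
  unfolding cinf_seminorm_def by (intro cSup_upper seminorm_bdd) auto

lemma seminorm_triangle:
  assumes "h \<in> Cinf A" "k \<in> Cinf A" "l \<in> Cinf A"
  shows "sn i j (\<lambda>x. h x - l x) \<le> sn i j (\<lambda>x. h x - k x) + sn i j (\<lambda>x. k x - l x)"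
proof (rule seminorm_le)
  have C: "(\<lambda>x. h x - k x) \<in> Cinf A" "(\<lambda>x. k x - l x) \<in> Cinf A"
    using assms by (auto intro: Cinf_diff)
  show "0 \<le> sn i j (\<lambda>x. h x - k x) + sn i j (\<lambda>x. k x - l x)"
    using C by (simp add: seminorm_nonneg)
  fix p Xs assume p: "p \<in> K i" and Xs: "Xs \<in> unit_fields p j"
  then have Xs': "set Xs \<subseteq> VF" by (auto simp: unit_fields_def)
  show "\<bar>cov (\<lambda>x. h x - l x) Xs p\<bar> \<le> sn i j (\<lambda>x. h x - k x) + sn i j (\<lambda>x. k x - l x)"
    using cov_le_seminorm[OF C(1) p Xs] cov_le_seminorm[OF C(2) p Xs] assms Xs'
    by (simp add: cov_diff)
qed

lemma seminorm_zero: "sn i j (\<lambda>x. 0) = 0"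
proof (rule antisym)
  show "sn i j (\<lambda>x. 0) \<le> 0"
  proof (rule seminorm_le)
    fix p Xs assume "Xs \<in> unit_fields p j"
    then have "set Xs \<subseteq> VF" by (auto simp: unit_fields_def)
    then show "\<bar>cov (\<lambda>x. 0) Xs p\<bar> \<le> 0"
      using cov_diff[OF Cinf_const Cinf_const, of Xs 0 0 p] by simp
  qed simp
qed (simp add: seminorm_nonneg Cinf_const)

section \<open>Continuity and convergence in the topology generated by the seminorms\<close>

abbreviation "balls \<equiv> {{h \<in> Cinf A. sn i j (\<lambda>x. h x - k x) < r} | i j k r. k \<in> Cinf A \<and> r > 0}"

lemma openin_ball:
  "k \<in> Cinf A \<Longrightarrow> r > 0 \<Longrightarrow> openin \<T> {h \<in> Cinf A. sn i j (\<lambda>x. h x - k x) < r}"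
  unfolding cinf_topology_def by (intro topology_generated_by_Basis) blast

lemma topspace_cinf: "topspace \<T> = Cinf A"
proof
  show "Cinf A \<subseteq> topspace \<T>"
  proof
    fix h assume "h \<in> Cinf A"
    then show "h \<in> topspace \<T>"
      using openin_subset[OF openin_ball[of h 1 0 0]] by (auto simp: seminorm_zero)
  qed
qed (auto simp: cinf_topology_def)

lemma continuous_map_cinf:
  assumes T: "\<And>h. h \<in> Cinf A \<Longrightarrow> T h \<in> Cinf A"
    and lin: "\<And>h k. h \<in> Cinf A \<Longrightarrow> k \<in> Cinf A \<Longrightarrow> T (\<lambda>x. h x - k x) = (\<lambda>x. T h x - T k x)"
    and bound: "\<And>i j. \<exists>C i' J. C \<ge> 0 \<and> (\<forall>h\<in>Cinf A. sn i j (T h) \<le> C * (\<Sum>j'<J. sn i' j' h))"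
  shows "continuous_map \<T> \<T> T"
proof -
  have "continuous_map \<T> (topology_generated_by balls) T"
  proof (rule continuous_on_generated_topo)
    fix B assume "B \<in> balls"
    then obtain i j k r where k: "k \<in> Cinf A" and B: "B = {h \<in> Cinf A. sn i j (\<lambda>x. h x - k x) < r}"
      by blast
    obtain C i' J where C: "C \<ge> 0" "\<And>h. h \<in> Cinf A \<Longrightarrow> sn i j (T h) \<le> C * (\<Sum>j'<J. sn i' j' h)"
      using bound by meson
    show "openin \<T> (T -` B \<inter> topspace \<T>)"
    proof (subst openin_subopen, intro ballI)
      fix h assume "h \<in> T -` B \<inter> topspace \<T>"
      then have h: "h \<in> Cinf A" and Th: "sn i j (\<lambda>x. T h x - k x) < r"
        by (auto simp: B topspace_cinf)
      \<comment> \<open>The radius spreads the gap to r over J seminorms with factor C. The summand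
        1 excludes a zero denominator and makes the final estimate strict.\<close>
      define \<delta> where "\<delta> = (r - sn i j (\<lambda>x. T h x - k x)) / (C * real J + 1)"
      have pos: "C * real J + 1 > 0" using C(1) by (simp add: add_nonneg_pos)
      then have \<delta>: "\<delta> > 0" using Th by (simp add: \<delta>_def)
      \<comment> \<open>For J = 0 the intersection over j' is the whole type, and only
        \<open>topspace \<T>\<close> confines the set to smooth functions.\<close>
      let ?O = "(\<Inter>j'\<in>{..<J}. {h' \<in> Cinf A. sn i' j' (\<lambda>x. h' x - h x) < \<delta>}) \<inter> topspace \<T>"
      have "openin \<T> ?O"
        by (intro openin_INT openin_ball h \<delta>) simp
      moreover have "h \<in> ?O"
        using h \<delta> by (auto simp: topspace_cinf seminorm_zero)
      moreover have "?O \<subseteq> T -` B \<inter> topspace \<T>"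
      proof
        fix h' assume "h' \<in> ?O"
        then have h': "h' \<in> Cinf A" and less: "\<And>j'. j' < J \<Longrightarrow> sn i' j' (\<lambda>x. h' x - h x) < \<delta>"
          by (auto simp: topspace_cinf)
        have "sn i j (\<lambda>x. T h' x - T h x) = sn i j (T (\<lambda>x. h' x - h x))"
          using lin[OF h' h] by simp
        also have "\<dots> \<le> C * (\<Sum>j'<J. sn i' j' (\<lambda>x. h' x - h x))"
          by (intro C(2) Cinf_diff h' h)
        also have "\<dots> \<le> C * (\<Sum>j'<J. \<delta>)"
          by (intro mult_left_mono sum_mono C(1)) (auto intro: less_imp_le less)
        also have "\<dots> < (C * real J + 1) * \<delta>"
          using \<delta> by (simp add: algebra_simps)
        also have "\<dots> = r - sn i j (\<lambda>x. T h x - k x)"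
          using pos by (simp add: \<delta>_def)
        finally have "sn i j (\<lambda>x. T h' x - k x) < r"
          using seminorm_triangle[OF T[OF h'] T[OF h] k, of i j] by simp
        then show "h' \<in> T -` B \<inter> topspace \<T>"
          using h' T by (simp add: B topspace_cinf)
      qed
      ultimately show "\<exists>O'. openin \<T> O' \<and> h \<in> O' \<and> O' \<subseteq> T -` B \<inter> topspace \<T>"
        by blast
    qed
  next
    show "T ` topspace \<T> \<subseteq> \<Union> balls"
    proof
      fix u assume "u \<in> T ` topspace \<T>"
      then have u: "u \<in> Cinf A" using T by (auto simp: topspace_cinf)
      then have "u \<in> {h \<in> Cinf A. sn 0 0 (\<lambda>x. h x - u x) < 1}"
        by (simp add: seminorm_zero)
      then show "u \<in> \<Union> balls"
        using u zero_less_one by blast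
    qed
  qed
  then show ?thesis by (simp add: cinf_topology_def)
qed

lemma limitin_cinf:
  assumes l: "l \<in> Cinf A" and f: "\<And>s. f s \<in> Cinf A"
    and lim: "\<And>i j. ((\<lambda>s. sn i j (\<lambda>x. f s x - l x)) \<longlongrightarrow> 0) F"
  shows "limitin \<T> f l F"
  unfolding limitin_def
proof (intro conjI allI impI)
  show "l \<in> topspace \<T>" using l by (simp add: topspace_cinf)
  fix W assume "openin \<T> W \<and> l \<in> W"
  then have W: "generate_topology_on balls W" and lW: "l \<in> W"
    unfolding cinf_topology_def openin_topology_generated_by_iff by auto
  show "\<forall>\<^sub>F s in F. f s \<in> W"
    using W lW
  proof (induction W)
    case (Int a b)
    then show ?case by (simp add: eventually_conj)
  next
    case (UN \<K>)
    then obtain k where "k \<in> \<K>" "l \<in> k" by blast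
    with UN.IH have "\<forall>\<^sub>F s in F. f s \<in> k" by blast
    then show ?case
      by (rule eventually_mono) (use \<open>k \<in> \<K>\<close> in blast)
  next
    \<comment> \<open>The ball is centred at some k other than l in general; what remains for f s is
      the gap between r and the seminorm of l - k.\<close>
    case (Basis B)
    then obtain i j k r where k: "k \<in> Cinf A" and B: "B = {h \<in> Cinf A. sn i j (\<lambda>x. h x - k x) < r}"
      by blast
    have "sn i j (\<lambda>x. l x - k x) < r" using Basis.prems B by simp
    then have "\<forall>\<^sub>F s in F. sn i j (\<lambda>x. f s x - l x) < r - sn i j (\<lambda>x. l x - k x)"
      by (intro order_tendstoD(2)[OF lim]) simp
    then show ?case
    proof eventually_elim
      case (elim s)
      then show ?case
        using seminorm_triangle[OF f[of s] l k, of i j] f[of s] by (simp add: B)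
    qed
  qed simp
qed

section \<open>Pulling back covariant derivatives along a diffeomorphism\<close>

inductive cov_op :: "(('a \<Rightarrow> real) \<Rightarrow> 'a \<Rightarrow> real) \<Rightarrow> bool" where
  cov_op_cov: "set Xs \<subseteq> VF \<Longrightarrow> cov_op (\<lambda>h. cov h Xs)"
| cov_op_lincomb: "cov_op D \<Longrightarrow> cov_op D' \<Longrightarrow> cov_op (\<lambda>h p. a * D h p + b * D' h p)"

lemma cov_op_Cinf: "cov_op D \<Longrightarrow> h \<in> Cinf A \<Longrightarrow> D h \<in> Cinf A"
  by (induction rule: cov_op.induct) (auto intro!: cov_Cinf Cinf_add Cinf_cmult)

lemma cov_op_add: "cov_op D \<Longrightarrow> cov_op D' \<Longrightarrow> cov_op (\<lambda>h p. D h p + D' h p)"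
  using cov_op_lincomb[of D D' 1 1] by simp

lemma cov_op_diff: "cov_op D \<Longrightarrow> cov_op D' \<Longrightarrow> cov_op (\<lambda>h p. D h p - D' h p)"
  using cov_op_lincomb[of D D' 1 "-1"] by simp

lemma cov_op_sum:
  "(\<And>i. i \<in> I \<Longrightarrow> cov_op (D i)) \<Longrightarrow> cov_op (\<lambda>h p. \<Sum>i\<in>I. D i h p)"
proof (induction I rule: infinite_finite_induct)
  case (insert i I)
  then show ?case by (simp add: cov_op_add)
qed (use cov_op_lincomb[OF cov_op_cov[of "[]"] cov_op_cov[of "[]"], of 0 0] in auto)

text \<open>The recursion of \<open>cov_deriv\<close>, solved for X (cov h Xs), writes it as
  \<open>cov h (X # Xs)\<close> plus the connection terms. Only real coefficients occur. Linearity
  of X is available on smooth arguments, hence the restriction to h in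
  \<open>Cinf A\<close>.\<close>

lemma cov_op_field:
  assumes X: "X \<in> VF" and "cov_op D"
  shows "\<exists>D'. cov_op D' \<and> (\<forall>h\<in>Cinf A. \<forall>p. D' h p = X p (D h))"
  using assms(2)
proof (induction rule: cov_op.induct)
  case (cov_op_cov Xs)
  have "cov_op (\<lambda>h p. cov h (X # Xs) p + (\<Sum>l<length Xs. cov h (Xs[l := conn X (Xs ! l)]) p))"
    using cov_op_cov X set_update_conn_VF[OF cov_op_cov X]
    by (intro cov_op_add cov_op_sum cov_op.cov_op_cov) auto
  then show ?case by (intro exI conjI) auto
next
  case (cov_op_lincomb D D' a b)
  then obtain E E' where E: "cov_op E" "\<And>h p. h \<in> Cinf A \<Longrightarrow> E h p = X p (D h)"
    and E': "cov_op E'" "\<And>h p. h \<in> Cinf A \<Longrightarrow> E' h p = X p (D' h)" by blast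
  have "X p (\<lambda>q. a * D h q + b * D' h q) = a * E h p + b * E' h p" if "h \<in> Cinf A" for h p
    using tangent_lincomb[OF vector_fieldD[OF X] cov_op_Cinf[OF cov_op_lincomb(1) that]
        cov_op_Cinf[OF cov_op_lincomb(2) that]] E(2) E'(2) that by simp
  then show ?case
    using cov_op.cov_op_lincomb[OF E(1) E'(1), of a b] by (intro exI conjI) auto
qed

lemma cov_scale:
  assumes h: "h \<in> Cinf A" and Ys: "set Ys \<subseteq> VF" and Xs: "set Xs \<subseteq> VF"
  shows "cov h (Ys @ map (\<lambda>X p k. c * X p k) Xs) p = c ^ length Xs * cov h (Ys @ Xs) p"
  using Ys Xs
proof (induction Xs arbitrary: Ys)
  case (Cons X Xs)
  have X: "X \<in> VF" and Xs: "set Xs \<subseteq> VF" using Cons.prems by auto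
  have eq: "(\<lambda>p k. c * X p k) = vf_comb (\<lambda>_. c) X (\<lambda>_. 0) X"
    by (simp add: vf_comb_def)
  have cX: "(\<lambda>p k. c * X p k) \<in> VF"
    unfolding eq by (intro vector_field_comb X Cinf_const)
  have "cov h (Ys @ (\<lambda>p k. c * X p k) # Xs) p = c * cov h (Ys @ X # Xs) p"
    using cov_slot[OF h Cinf_const[of c] Cinf_const[of 0] X X, of "Ys @ X # Xs" "length Ys" p]
      Cons.prems Xs by (simp add: eq)
  then show ?case
    using Cons.IH[of "Ys @ [\<lambda>p k. c * X p k]"] Cons.prems cX Xs by simp
qed simp

lemma fields_bounded:
  assumes "compact L" "set Xs \<subseteq> VF"
  shows "\<exists>m>0. \<forall>X\<in>set Xs. \<forall>p\<in>L. g p (X p) (X p) \<le> m\<^sup>2"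
proof -
  have "bounded (\<Union>X\<in>set Xs. (\<lambda>p. g p (X p) (X p)) ` L)"
  proof (intro bounded_UN finite_set ballI compact_imp_bounded)
    fix X assume "X \<in> set Xs"
    then have "(\<lambda>p. g p (X p) (X p)) \<in> Cinf A"
      using metric assms(2) by (auto simp: riemannian_metric_def)
    then show "compact ((\<lambda>p. g p (X p) (X p)) ` L)"
      using assms(1) by (intro compact_continuous_image continuous_on_subset[OF Cinf_continuous]) auto
  qed
  then obtain M where M: "M > 0" "\<And>X p. X \<in> set Xs \<Longrightarrow> p \<in> L \<Longrightarrow> \<bar>g p (X p) (X p)\<bar> \<le> M"
    unfolding bounded_pos by auto
  show ?thesis
    by (rule exI[of _ "sqrt M"]) (use M in \<open>auto intro: order_trans[OF abs_ge_self]\<close>)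
qed

text \<open>Fixed fields have length at most some m on the compact \<open>K i\<close>. Dividing by m
  gives a unit tuple, and multilinearity returns the factor m ^ length. The sum over orders makes
  the bound stable under combining operators of different orders.\<close>

lemma cov_op_bound:
  assumes "cov_op D"
  shows "\<exists>C J. C \<ge> 0 \<and> (\<forall>h\<in>Cinf A. \<forall>p\<in>K i. \<bar>D h p\<bar> \<le> C * (\<Sum>j<J. sn i j h))"
  using assms
proof (induction rule: cov_op.induct)
  case (cov_op_cov Xs)
  obtain m where m: "m > 0" "\<And>X p. X \<in> set Xs \<Longrightarrow> p \<in> K i \<Longrightarrow> g p (X p) (X p) \<le> m\<^sup>2"
    using fields_bounded[OF compact_K cov_op_cov, of i] by blast
  let ?sc = "\<lambda>X p k. (1 / m) * X p k"
  have bound: "\<bar>cov h Xs p\<bar> \<le> m ^ length Xs * (\<Sum>j<Suc (length Xs). sn i j h)"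
    if h: "h \<in> Cinf A" and p: "p \<in> K i" for h p
  proof -
    have "?sc X \<in> VF \<and> g p (?sc X p) (?sc X p) \<le> 1" if X: "X \<in> set Xs" for X
    proof
      have XV: "X \<in> VF" using X cov_op_cov by auto
      have eq: "?sc X = vf_comb (\<lambda>_. 1 / m) X (\<lambda>_. 0) X"
        by (simp add: vf_comb_def)
      show scX: "?sc X \<in> VF"
        unfolding eq by (intro vector_field_comb XV Cinf_const)
      have lin: "g p (?sc X p) z = (1 / m) * g p (X p) z" if "z \<in> tangent_space A p" for z
        using metric_lincomb[OF vector_fieldD[OF XV] vector_fieldD[OF XV] that, of "1 / m" 0] by simp
      have "g p (?sc X p) (?sc X p) = (1 / m) * g p (X p) (?sc X p)"
        using vector_fieldD[OF scX, of p] by (intro lin) simp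
      also have "g p (X p) (?sc X p) = g p (?sc X p) (X p)"
        using vector_fieldD[OF scX, of p] vector_fieldD[OF XV] by (intro metric_sym) auto
      also have "\<dots> = (1 / m) * g p (X p) (X p)"
        by (intro lin vector_fieldD[OF XV])
      also have "(1 / m) * ((1 / m) * g p (X p) (X p)) \<le> 1"
        using m(1) m(2)[OF X p] by (simp add: field_simps power2_eq_square)
      finally show "g p (?sc X p) (?sc X p) \<le> 1" .
    qed
    then have "map ?sc Xs \<in> unit_fields p (length Xs)"
      by (auto simp: unit_fields_def)
    then have "\<bar>cov h (map ?sc Xs) p\<bar> \<le> sn i (length Xs) h"
      by (rule cov_le_seminorm[OF h p])
    also have "\<dots> \<le> (\<Sum>j<Suc (length Xs). sn i j h)"
      using seminorm_nonneg[OF h] by (intro member_le_sum) auto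
    finally have le: "\<bar>cov h (map ?sc Xs) p\<bar> \<le> (\<Sum>j<Suc (length Xs). sn i j h)" .
    have "cov h Xs p = m ^ length Xs * cov h (map ?sc Xs) p"
      using cov_scale[OF h _ cov_op_cov, of "[]" "1 / m" p] m(1) by (simp add: power_one_over)
    then have "\<bar>cov h Xs p\<bar> = m ^ length Xs * \<bar>cov h (map ?sc Xs) p\<bar>"
      using m(1) by (simp add: abs_mult)
    then show ?thesis
      using mult_left_mono[OF le, of "m ^ length Xs"] m(1) by simp
  qed
  then show ?case
    using m(1) by (intro exI[of _ "m ^ length Xs"] exI[of _ "Suc (length Xs)"]) auto
next
  case (cov_op_lincomb D D' a b)
  then obtain C J C' J' where C: "C \<ge> 0" "\<And>h p. h \<in> Cinf A \<Longrightarrow> p \<in> K i \<Longrightarrow> \<bar>D h p\<bar> \<le> C * (\<Sum>j<J. sn i j h)"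
    and C': "C' \<ge> 0" "\<And>h p. h \<in> Cinf A \<Longrightarrow> p \<in> K i \<Longrightarrow> \<bar>D' h p\<bar> \<le> C' * (\<Sum>j<J'. sn i j h)"
    by meson
  have "\<bar>a * D h p + b * D' h p\<bar> \<le> (\<bar>a\<bar> * C + \<bar>b\<bar> * C') * (\<Sum>j<J + J'. sn i j h)"
    if h: "h \<in> Cinf A" and p: "p \<in> K i" for h p
  proof -
    let ?S = "\<Sum>j<J + J'. sn i j h"
    have "(\<Sum>j<J. sn i j h) \<le> ?S" "(\<Sum>j<J'. sn i j h) \<le> ?S"
      using seminorm_nonneg[OF h] by (auto intro!: sum_mono2)
    then have "\<bar>D h p\<bar> \<le> C * ?S" "\<bar>D' h p\<bar> \<le> C' * ?S"
      using C(2)[OF h p] C'(2)[OF h p] C(1) C'(1) by (meson mult_left_mono order_trans)+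
    then have "\<bar>a\<bar> * \<bar>D h p\<bar> + \<bar>b\<bar> * \<bar>D' h p\<bar> \<le> \<bar>a\<bar> * (C * ?S) + \<bar>b\<bar> * (C' * ?S)"
      by (intro add_mono mult_left_mono) auto
    moreover have "\<bar>a * D h p + b * D' h p\<bar> \<le> \<bar>a\<bar> * \<bar>D h p\<bar> + \<bar>b\<bar> * \<bar>D' h p\<bar>"
      by (metis abs_mult abs_triangle_ineq)
    ultimately show ?thesis
      by (simp add: algebra_simps)
  qed
  then show ?case
    using C(1) C'(1) by (intro exI[of _ "\<bar>a\<bar> * C + \<bar>b\<bar> * C'"] exI[of _ "J + J'"]) auto
qed

context
  fixes \<Theta> \<Theta>' :: "'a \<Rightarrow> 'a"
  assumes pull: "\<And>h. h \<in> Cinf A \<Longrightarrow> (\<lambda>x. h (\<Theta> x)) \<in> Cinf A"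
    and pull': "\<And>h. h \<in> Cinf A \<Longrightarrow> (\<lambda>x. h (\<Theta>' x)) \<in> Cinf A"
    and inv: "\<And>x. \<Theta> (\<Theta>' x) = x" "\<And>x. \<Theta>' (\<Theta> x) = x"
begin

text \<open>The pushforward of X along \<Theta>; the default 0 is the convention for tangent vectors
  on nonsmooth functions.\<close>

definition push :: "'a vfield \<Rightarrow> 'a vfield" where
  "push X = (\<lambda>q h. if h \<in> Cinf A then X (\<Theta>' q) (\<lambda>x. h (\<Theta> x)) else 0)"

lemma push_VF:
  assumes X: "X \<in> VF"
  shows "push X \<in> VF"
  unfolding vector_fields_def mem_Collect_eq
proof (intro conjI allI ballI)
  fix q
  note T = vector_fieldD[OF X, of "\<Theta>' q"]
  show "push X q \<in> tangent_space A q"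
    unfolding tangent_space_def mem_Collect_eq
  proof (intro conjI ballI allI impI)
    fix h k a b assume "h \<in> Cinf A" "k \<in> Cinf A"
    then show "push X q (\<lambda>x. a * h x + b * k x) = a * push X q h + b * push X q k"
      using tangent_lincomb[OF T pull pull] by (simp add: push_def Cinf_add Cinf_cmult)
  next
    fix h k assume "h \<in> Cinf A" "k \<in> Cinf A"
    then show "push X q (\<lambda>x. h x * k x) = h q * push X q k + k q * push X q h"
      using tangent_mult[OF T pull pull] by (simp add: push_def Cinf_mult inv)
  qed (simp add: push_def)
next
  fix h assume h: "h \<in> Cinf A"
  show "(\<lambda>q. push X q h) \<in> Cinf A"
    using pull'[OF vector_field_Cinf[OF X pull[OF h]]] h by (simp add: push_def)
qed

text \<open>X (k o \<Theta>) is \<open>push X\<close> applied to k, composed with \<Theta>, and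
  \<open>cov_op_field\<close> absorbs this new derivative. The connection terms stay as they are:
  they are again pullback derivatives of shorter tuples and fall under the induction
  hypothesis.\<close>

lemma cov_pull:
  assumes "set Xs \<subseteq> VF"
  shows "\<exists>D. cov_op D \<and> (\<forall>h\<in>Cinf A. \<forall>p. cov (\<lambda>x. h (\<Theta> x)) Xs p = D h (\<Theta> p))"
  using assms
proof (induction Xs rule: measure_induct_rule[of length])
  case (less Xs)
  show ?case
  proof (cases Xs)
    case Nil
    then show ?thesis
      by (intro exI[of _ "\<lambda>h. cov h []"] conjI cov_op_cov) auto
  next
    case (Cons X Ys)
    have X: "X \<in> VF" and Ys: "set Ys \<subseteq> VF"
      using less.prems Cons by auto
    obtain D0 where D0: "cov_op D0" "\<And>h p. h \<in> Cinf A \<Longrightarrow> cov (\<lambda>x. h (\<Theta> x)) Ys p = D0 h (\<Theta> p)"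
      using less.IH[of Ys] Ys Cons by auto
    obtain D1 where D1: "cov_op D1" "\<And>h p. h \<in> Cinf A \<Longrightarrow> D1 h p = push X p (D0 h)"
      using cov_op_field[OF push_VF[OF X] D0(1)] by blast
    have "\<forall>l\<in>{..<length Ys}. \<exists>D. cov_op D \<and>
        (\<forall>h\<in>Cinf A. \<forall>p. cov (\<lambda>x. h (\<Theta> x)) (Ys[l := conn X (Ys ! l)]) p = D h (\<Theta> p))"
      using less.IH set_update_conn_VF[OF Ys X] Cons by simp
    then obtain D where D: "\<And>l. l < length Ys \<Longrightarrow> cov_op (D l)"
      "\<And>l h p. l < length Ys \<Longrightarrow> h \<in> Cinf A \<Longrightarrow>
        cov (\<lambda>x. h (\<Theta> x)) (Ys[l := conn X (Ys ! l)]) p = D l h (\<Theta> p)"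
      by (subst (asm) bchoice_iff) auto
    have "cov (\<lambda>x. h (\<Theta> x)) Xs p = D1 h (\<Theta> p) - (\<Sum>l<length Ys. D l h (\<Theta> p))" if h: "h \<in> Cinf A" for h p
    proof -
      have "cov (\<lambda>x. h (\<Theta> x)) Ys = (\<lambda>q. D0 h (\<Theta> q))"
        using D0(2)[OF h] by (simp add: fun_eq_iff)
      then have "X p (cov (\<lambda>x. h (\<Theta> x)) Ys) = D1 h (\<Theta> p)"
        using D1(2)[OF h] cov_op_Cinf[OF D0(1) h] by (simp add: push_def inv)
      then show ?thesis
        using D(2) h by (simp add: Cons)
    qed
    moreover have "cov_op (\<lambda>h p. D1 h p - (\<Sum>l<length Ys. D l h p))"
      using D(1) by (intro cov_op_diff D1(1) cov_op_sum) auto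
    ultimately show ?thesis by blast
  qed
qed

text \<open>The supremum over unit tuples on \<open>K i\<close> reduces to finitely many fixed
  tuples, each of which becomes an operator in h evaluated on \<Theta> (K i), a compact set inside
  some \<open>K i'\<close>.\<close>

lemma pullback_seminorm_bound:
  assumes cont: "continuous_on UNIV \<Theta>"
  shows "\<exists>C i' J. C \<ge> 0 \<and> (\<forall>h\<in>Cinf A. sn i j (\<lambda>x. h (\<Theta> x)) \<le> C * (\<Sum>j'<J. sn i' j' h))"
proof (rule compact_cov_bound[OF compact_K, of i j])
  fix \<E> C
  assume \<E>: "finite \<E>" "\<And>Es. Es \<in> \<E> \<Longrightarrow> set Es \<subseteq> VF" and "C \<ge> 0"
    and C: "\<And>p h Xs M. p \<in> K i \<Longrightarrow> h \<in> Cinf A \<Longrightarrow> Xs \<in> unit_fields p j \<Longrightarrow> 0 \<le> M \<Longrightarrow>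
      (\<And>Es. Es \<in> \<E> \<Longrightarrow> \<bar>cov h Es p\<bar> \<le> M) \<Longrightarrow> \<bar>cov h Xs p\<bar> \<le> C * M"
  have "compact (\<Theta> ` K i)"
    by (intro compact_continuous_image compact_K continuous_on_subset[OF cont]) simp
  then obtain i' where i': "\<Theta> ` K i \<subseteq> K i'"
    by (rule compact_subset_K)
  have "\<exists>c J. c \<ge> 0 \<and> (\<forall>h\<in>Cinf A. \<forall>p\<in>K i. \<bar>cov (\<lambda>x. h (\<Theta> x)) Es p\<bar> \<le> c * (\<Sum>j<J. sn i' j h))"
    if Es: "Es \<in> \<E>" for Es
  proof -
    obtain D where D: "cov_op D" "\<And>h p. h \<in> Cinf A \<Longrightarrow> cov (\<lambda>x. h (\<Theta> x)) Es p = D h (\<Theta> p)"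
      using cov_pull[OF \<E>(2)[OF Es]] by blast
    obtain c J where c: "c \<ge> 0" "\<And>h p. h \<in> Cinf A \<Longrightarrow> p \<in> K i' \<Longrightarrow> \<bar>D h p\<bar> \<le> c * (\<Sum>j<J. sn i' j h)"
      using cov_op_bound[OF D(1), of i'] by blast
    show ?thesis
    proof (intro exI conjI ballI)
      show "c \<ge> 0" by (rule c(1))
      fix h p assume "h \<in> Cinf A" "p \<in> K i"
      then show "\<bar>cov (\<lambda>x. h (\<Theta> x)) Es p\<bar> \<le> c * (\<Sum>j<J. sn i' j h)"
        using c(2)[of h "\<Theta> p"] D(2) i' by auto
    qed
  qed
  then have "\<forall>Es\<in>\<E>. \<exists>c J. c \<ge> 0 \<and> (\<forall>h\<in>Cinf A. \<forall>p\<in>K i. \<bar>cov (\<lambda>x. h (\<Theta> x)) Es p\<bar> \<le> c * (\<Sum>j<J. sn i' j h))"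
    by blast
  then obtain c where "\<forall>Es\<in>\<E>. \<exists>J. c Es \<ge> 0 \<and>
      (\<forall>h\<in>Cinf A. \<forall>p\<in>K i. \<bar>cov (\<lambda>x. h (\<Theta> x)) Es p\<bar> \<le> c Es * (\<Sum>j<J. sn i' j h))"
    by (subst (asm) bchoice_iff) blast
  then obtain J where cJ: "\<And>Es. Es \<in> \<E> \<Longrightarrow> c Es \<ge> 0"
    "\<And>Es h p. Es \<in> \<E> \<Longrightarrow> h \<in> Cinf A \<Longrightarrow> p \<in> K i \<Longrightarrow>
      \<bar>cov (\<lambda>x. h (\<Theta> x)) Es p\<bar> \<le> c Es * (\<Sum>j<J Es. sn i' j h)"
    by (subst (asm) bchoice_iff) blast
  \<comment> \<open>Sums over the finite family serve as common upper bounds for the constants and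
    for the orders.\<close>
  let ?c = "\<Sum>Es\<in>\<E>. c Es" and ?J = "\<Sum>Es\<in>\<E>. J Es"
  have c0: "?c \<ge> 0" using cJ(1) by (intro sum_nonneg)
  show ?thesis
  proof (intro exI conjI ballI)
    show "C * ?c \<ge> 0" using \<open>C \<ge> 0\<close> c0 by simp
    fix h assume h: "h \<in> Cinf A"
    let ?S = "\<Sum>j<?J. sn i' j h"
    have S: "?S \<ge> 0" by (intro sum_nonneg seminorm_nonneg h)
    show "sn i j (\<lambda>x. h (\<Theta> x)) \<le> C * ?c * ?S"
    proof (rule seminorm_le)
      show "0 \<le> C * ?c * ?S" using \<open>C \<ge> 0\<close> c0 S by simp
      fix p Xs assume p: "p \<in> K i" and Xs: "Xs \<in> unit_fields p j"
      have "\<bar>cov (\<lambda>x. h (\<Theta> x)) Xs p\<bar> \<le> C * (?c * ?S)"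
      proof (rule C[OF p pull[OF h] Xs])
        show "0 \<le> ?c * ?S" using c0 S by simp
        fix Es assume Es: "Es \<in> \<E>"
        have "\<bar>cov (\<lambda>x. h (\<Theta> x)) Es p\<bar> \<le> c Es * (\<Sum>j<J Es. sn i' j h)"
          by (rule cJ(2)[OF Es h p])
        also have "\<dots> \<le> ?c * ?S"
        proof (intro mult_mono)
          show "c Es \<le> ?c" using Es \<E>(1) cJ(1) by (intro member_le_sum) auto
          have "J Es \<le> ?J" using Es \<E>(1) by (intro member_le_sum) auto
          then show "(\<Sum>j<J Es. sn i' j h) \<le> ?S"
            by (intro sum_mono2) (auto intro: seminorm_nonneg h)
        qed (use c0 h in \<open>auto intro: sum_nonneg seminorm_nonneg\<close>)
        finally show "\<bar>cov (\<lambda>x. h (\<Theta> x)) Es p\<bar> \<le> ?c * ?S" .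
      qed
      then show "\<bar>cov (\<lambda>x. h (\<Theta> x)) Xs p\<bar> \<le> C * ?c * ?S"
        by (simp add: mult.assoc)
    qed
  qed
qed

end

end

section \<open>Functions depending on time\<close>

context manifold
begin

lemma time_chart_image: "(\<lambda>(t::real, p). (t, \<phi> p)) ` (UNIV \<times> U) = UNIV \<times> \<phi> ` U"
  by force

lemma time_chart_inv:
  assumes U: "(U, \<phi>) \<in> A" and y: "y \<in> UNIV \<times> \<phi> ` U"
  shows "inv_into (UNIV \<times> U) (\<lambda>(t::real, p). (t, \<phi> p)) y = (fst y, inv_into U \<phi> (snd y))"
proof (rule inv_into_f_eq)
  have "inj_on \<phi> U"
    using chart_inv[OF U] by (metis inj_onI)
  then show "inj_on (\<lambda>(t::real, p). (t, \<phi> p)) (UNIV \<times> U)"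
    by (auto simp: inj_on_def)
qed (use y chart_inv[OF U] in auto)

lemma time_open: "(U, \<phi>) \<in> A \<Longrightarrow> open (UNIV \<times> \<phi> ` U :: (real \<times> 'e) set)"
  by (intro open_Times open_UNIV chart_image_open)

lemma Cinf_timeI:
  assumes "\<And>U \<phi> k. (U, \<phi>) \<in> A \<Longrightarrow> Ck_on k (UNIV \<times> \<phi> ` U) (\<lambda>y. f (fst y, inv_into U \<phi> (snd y)))"
  shows "f \<in> Cinf (time_atlas A)"
proof (rule CinfI)
  fix W \<xi> k assume "(W, \<xi>) \<in> time_atlas A"
  then obtain U \<phi> where U: "(U, \<phi>) \<in> A" and W: "W = UNIV \<times> U" "\<xi> = (\<lambda>(t, p). (t, \<phi> p))"
    by (auto simp: time_atlas_def)
  show "Ck_on k (\<xi> ` W) (\<lambda>y. f (inv_into W \<xi> y))"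
    unfolding W time_chart_image
    by (rule Ck_on_cong[OF time_open[OF U] _ assms[OF U]]) (simp add: time_chart_inv[OF U])
qed

lemma Cinf_timeD:
  assumes "f \<in> Cinf (time_atlas A)" and U: "(U, \<phi>) \<in> A"
  shows "Ck_on k (UNIV \<times> \<phi> ` U) (\<lambda>y. f (fst y, inv_into U \<phi> (snd y)))"
proof -
  have "(UNIV \<times> U, \<lambda>(t, p). (t, \<phi> p)) \<in> time_atlas A"
    using U by (force simp: time_atlas_def)
  from CinfD[OF assms(1) this, of k] show ?thesis
    unfolding time_chart_image
    by (rule Ck_on_cong[OF time_open[OF U], rotated]) (simp add: time_chart_inv[OF U])
qed

lemma open_atlas_time: "open_atlas (time_atlas A)"
proof
  fix W \<xi> assume "(W, \<xi>) \<in> time_atlas A"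
  then show "open (\<xi> ` W)"
    by (auto simp: time_atlas_def time_chart_image intro: time_open)
qed

sublocale time: open_atlas "time_atlas A"
  by (rule open_atlas_time)

lemma Cinf_time_slice:
  assumes "f \<in> Cinf (time_atlas A)"
  shows "(\<lambda>x. f (t, x)) \<in> Cinf A"
proof (rule CinfI)
  fix U \<phi> k assume U: "(U, \<phi>) \<in> A"
  have "Ck_on k (\<phi> ` U) (\<lambda>x. (t, 0) + (0, x))"
    by (intro Ck_on_add Ck_on_const Ck_on_linear chart_image_open[OF U] bounded_linear_Pair
        bounded_linear_zero bounded_linear_ident)
  then have "Ck_on k (\<phi> ` U) (\<lambda>x. (t, x))"
    by simp
  from Ck_on_compose[OF chart_image_open[OF U] this _ Cinf_timeD[OF assms U]]
  show "Ck_on k (\<phi> ` U) (\<lambda>x. f (t, inv_into U \<phi> x))"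
    by auto
qed

lemma Cinf_time_const:
  assumes "h \<in> Cinf A"
  shows "(\<lambda>y. h (snd y)) \<in> Cinf (time_atlas A)"
proof (rule Cinf_timeI)
  fix U \<phi> k assume U: "(U, \<phi>) \<in> A"
  have "Ck_on k (UNIV \<times> \<phi> ` U) (snd :: real \<times> 'e \<Rightarrow> 'e)"
    by (intro Ck_on_linear bounded_linear_snd time_open U)
  from Ck_on_compose[OF time_open[OF U] this _ CinfD[OF assms U]]
  show "Ck_on k (UNIV \<times> \<phi> ` U) (\<lambda>y. h (snd (fst y :: real, inv_into U \<phi> (snd y))))"
    by auto
qed

lemma Cinf_time_continuous:
  assumes "f \<in> Cinf (time_atlas A)"
  shows "continuous_on UNIV f"
proof (rule continuous_at_imp_continuous_on, rule ballI)
  fix z :: "real \<times> 'a"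
  obtain U \<phi> where U: "(U, \<phi>) \<in> A" "snd z \<in> U" using chart_cover by blast
  have "continuous_on (UNIV \<times> \<phi> ` U) (\<lambda>y. f (fst y, inv_into U \<phi> (snd y)))"
    using Cinf_timeD[OF assms U(1), of 0] by simp
  moreover have "continuous_on (UNIV \<times> U) (\<lambda>z::real \<times> 'a. (fst z, \<phi> (snd z)))"
    by (intro continuous_intros continuous_on_compose2[OF chart_cont[OF U(1)]]) auto
  ultimately have "continuous_on (UNIV \<times> U)
      (\<lambda>z. f (fst (fst z, \<phi> (snd z)), inv_into U \<phi> (snd (fst z, \<phi> (snd z)))))"
    by (rule continuous_on_compose2) auto
  then have "continuous_on (UNIV \<times> U) f"
    by (rule continuous_on_eq) (auto simp: chart_inv[OF U(1)])
  moreover have "open (UNIV \<times> U :: (real \<times> 'a) set)"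
    by (intro open_Times open_UNIV chart_open[OF U(1)])
  ultimately show "isCont f z"
    using U(2) by (cases z) (simp add: continuous_on_eq_continuous_at)
qed

lemma Cinf_time_flow:
  assumes \<Phi>: "smooth_map (time_atlas A) A \<Phi>" and h: "h \<in> Cinf A"
  shows "(\<lambda>y. h (\<Phi> y)) \<in> Cinf (time_atlas A)"
proof (rule Cinf_timeI, rule Ck_on_local)
  fix U \<phi> k and y :: "real \<times> 'e" assume U: "(U, \<phi>) \<in> A" and y: "y \<in> UNIV \<times> \<phi> ` U"
  let ?i = "\<lambda>y::real \<times> 'e. (fst y, inv_into U \<phi> (snd y))" and ?\<xi> = "\<lambda>(t::real, p). (t, \<phi> p)"
  obtain W \<psi> where W: "(W, \<psi>) \<in> A" "\<Phi> (?i y) \<in> W" using chart_cover by blast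
  \<comment> \<open>\<open>smooth_map\<close> speaks of one pair of charts at a time.
    \<open>S\<close> is the open part of the coordinate domain that the flow sends into the single
    chart domain \<open>W\<close>.\<close>
  define S where "S = (UNIV \<times> \<phi> ` U) \<inter> (\<lambda>y. \<Phi> (?i y)) -` W"
  have cont: "continuous_on UNIV \<Phi>"
    using \<Phi> by (simp add: smooth_map_def)
  have "continuous_on (UNIV \<times> \<phi> ` U) ?i"
    by (intro continuous_intros continuous_on_compose2[OF chart_inv_cont[OF U]]) auto
  then have "continuous_on (UNIV \<times> \<phi> ` U) (\<lambda>y. \<Phi> (?i y))"
    by (rule continuous_on_compose2[OF cont]) simp
  then have S: "open S"
    unfolding S_def by (rule continuous_open_preimage[OF _ time_open[OF U] chart_open[OF W(1)]])
  have S_eq: "S = ?\<xi> ` ((UNIV \<times> U) \<inter> \<Phi> -` W)"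
    using chart_inv[OF U] by (auto simp: S_def image_iff)
  have "(UNIV \<times> U, ?\<xi>) \<in> time_atlas A"
    using U by (force simp: time_atlas_def)
  then have "Ck_on k S (\<psi> \<circ> \<Phi> \<circ> inv_into (UNIV \<times> U) ?\<xi>)"
    using \<Phi> W(1) unfolding smooth_map_def smooth_on_def S_eq by fast
  then have "Ck_on k S (\<lambda>y. \<psi> (\<Phi> (?i y)))"
    by (rule Ck_on_cong[OF S, rotated]) (simp add: time_chart_inv[OF U] S_def)
  then have "Ck_on k S (\<lambda>y. h (inv_into W \<psi> (\<psi> (\<Phi> (?i y)))))"
    by (rule Ck_on_compose[OF S _ _ CinfD[OF h W(1)]]) (auto simp: S_def)
  then have "Ck_on k S (\<lambda>y. h (\<Phi> (?i y)))"
    by (rule Ck_on_cong[OF S, rotated]) (simp add: chart_inv[OF W(1)] S_def)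
  then show "\<exists>T. open T \<and> y \<in> T \<and> Ck_on k T (\<lambda>y. h (\<Phi> (?i y)))"
    using S y W(2) by (intro exI[of _ S]) (auto simp: S_def)
qed

text \<open>In a chart, (\<theta> s, x) is (0, x) + \<theta> (s, 0), so
  \<open>Ck_on_integral\<close> applies. Such averages extend difference quotients smoothly across s
  = 0.\<close>

lemma Cinf_time_average:
  assumes "w \<in> Cinf (time_atlas A)"
  shows "(\<lambda>y. integral {0..1} (\<lambda>\<theta>. w (\<theta> * fst y, snd y))) \<in> Cinf (time_atlas A)"
proof (rule Cinf_timeI)
  fix U \<phi> k assume U: "(U, \<phi>) \<in> A"
  let ?P = "\<lambda>y::real \<times> 'e. (0::real, snd y)" and ?Q = "\<lambda>y::real \<times> 'e. (fst y, 0::'e)"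
  have "Ck_on k (UNIV \<times> \<phi> ` U) (\<lambda>y. integral {0..1} (\<lambda>t. t ^ 0 *
      (\<lambda>y. w (fst y, inv_into U \<phi> (snd y))) (0 + ?P y + t *\<^sub>R ?Q y)))"
    by (rule Ck_on_integral[OF time_open[OF U] _ _ _ Cinf_timeD[OF assms U]])
      (auto intro!: bounded_linear_Pair bounded_linear_zero bounded_linear_snd bounded_linear_fst)
  then show "Ck_on k (UNIV \<times> \<phi> ` U) (\<lambda>y. integral {0..1} (\<lambda>\<theta>. w (\<theta> * fst (fst y, inv_into U \<phi> (snd y)),
      snd (fst y, inv_into U \<phi> (snd y)))))"
    by simp
qed

text \<open>Membership in \<open>vector_fields\<close> gives smoothness in p for each fixed
  function, not jointly when the function varies with time. The frame writes X with smooth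
  time-independent coefficients, and a partial derivative of a slice of f is the derivative of f in
  direction (0, b).\<close>

lemma Cinf_time_field:
  assumes X: "X \<in> vector_fields A" and f: "f \<in> Cinf (time_atlas A)"
  shows "(\<lambda>y. X (snd y) (\<lambda>x. f (fst y, x))) \<in> Cinf (time_atlas A)"
proof (rule Cinf_timeI, rule Ck_on_local)
  fix U \<phi> k and y0 :: "real \<times> 'e" assume U: "(U, \<phi>) \<in> A" and y0: "y0 \<in> UNIV \<times> \<phi> ` U"
  let ?i = "inv_into U \<phi>" and ?S = "UNIV \<times> \<phi> ` U :: (real \<times> 'e) set"
  let ?f = "\<lambda>y. f (fst y, ?i (snd y))"
  have p0: "?i (snd y0) \<in> U"
    using y0 by (auto intro: inv_into_into)
  show "\<exists>T. open T \<and> y0 \<in> T \<and> Ck_on k T (\<lambda>y. X (snd (fst y, ?i (snd y))) (\<lambda>x. f (fst (fst y, ?i (snd y)), x)))"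
  proof (rule frame[OF U p0])
    fix \<rho> :: "'a \<Rightarrow> real" and Y :: "'e \<Rightarrow> 'a \<Rightarrow> real" and E :: "'e \<Rightarrow> 'a vfield"
    assume \<rho>: "\<rho> \<in> Cinf A" "\<rho> (?i (snd y0)) \<noteq> 0" and Y: "\<And>b. Y b \<in> Cinf A"
      and deriv: "\<And>p v h. v \<in> tangent_space A p \<Longrightarrow>
          \<rho> p ^ 3 * v h = (\<Sum>b\<in>Basis. (\<rho> p * v (Y b) - Y b p * v \<rho>) * E b p h)"
      and E: "\<And>b p h. h \<in> Cinf A \<Longrightarrow> p \<in> U \<Longrightarrow>
          E b p h = \<rho> p * frechet_derivative (\<lambda>x. h (?i x)) (at (\<phi> p)) b"
    define F where "F = (\<lambda>b p. \<rho> p * X p (Y b) - Y b p * X p \<rho>)"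
    have F: "F b \<in> Cinf A" for b
      unfolding F_def by (intro Cinf_diff Cinf_mult vector_field_Cinf[OF X Y] vector_field_Cinf[OF X \<rho>(1)] Y \<rho>(1))
    let ?R = "\<lambda>y::real \<times> 'e. \<rho> (?i (snd y))"
    let ?D = "\<lambda>y. frechet_derivative ?f (at y)"
    define T where "T = ?S \<inter> ?R -` (- {0})"
    have chart_snd: "Ck_on k ?S (\<lambda>y. h (?i (snd y)))" if "h \<in> Cinf A" for h k
      using Cinf_timeD[OF Cinf_time_const[OF that] U, of k] by simp
    have T: "open T"
      unfolding T_def
      by (rule continuous_open_preimage[OF _ time_open[OF U]]) (use chart_snd[OF \<rho>(1), of 0] in auto)
    have R: "Ck_on k T ?R"
      by (rule Ck_on_subset[OF chart_snd[OF \<rho>(1)]]) (auto simp: T_def)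
    have "Ck_on k T (\<lambda>y. \<Sum>b\<in>Basis. (F b (?i (snd y)) * (?R y * ?D y (0, b))) * inverse (?R y * ?R y * ?R y))"
    proof (intro Ck_on_sum T Ck_on_bilinear[OF bounded_bilinear_mult] Ck_on_inverse R)
      show "?R y * ?R y * ?R y \<noteq> 0" if "y \<in> T" for y
        using that by (simp add: T_def)
      show "Ck_on k T (\<lambda>y. ?D y (0, b))" for b
        by (rule Ck_on_subset[OF Ck_on_frechet_derivative[OF Cinf_timeD[OF f U]]]) (auto simp: T_def)
      show "Ck_on k T (\<lambda>y. F b (?i (snd y)))" for b
        by (rule Ck_on_subset[OF chart_snd[OF F]]) (auto simp: T_def)
    qed
    moreover have "(\<Sum>b\<in>Basis. (F b (?i (snd y)) * (?R y * ?D y (0, b))) * inverse (?R y * ?R y * ?R y)) =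
        X (?i (snd y)) (\<lambda>x. f (fst y, x))" if y: "y \<in> T" for y
    proof -
      define p where "p = ?i (snd y)"
      have yS: "y \<in> ?S" using y by (simp add: T_def)
      have p: "p \<in> U" "\<phi> p = snd y"
        using yS by (auto simp: p_def inv_into_into f_inv_into_f mem_Times_iff)
      have \<rho>p: "\<rho> p \<noteq> 0" using y by (simp add: T_def p_def)
      have "(?f has_derivative ?D y) (at (fst y, snd y))"
        using Ck_on_has_derivative[OF Cinf_timeD[OF f U] yS] by simp
      moreover have "((\<lambda>x. (fst y, x)) has_derivative (\<lambda>v. (0, v))) (at (snd y))"
        by (auto intro!: derivative_eq_intros)
      ultimately have "((\<lambda>x. ?f (fst y, x)) has_derivative (\<lambda>v. ?D y (0, v))) (at (snd y))"
        by (intro has_derivative_compose[where g = ?f and f = "\<lambda>x. (fst y, x)"])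
      then have "frechet_derivative (\<lambda>x. f (fst y, ?i x)) (at (snd y)) = (\<lambda>v. ?D y (0, v))"
        by (simp add: frechet_derivative_at[symmetric])
      then have "E b p (\<lambda>x. f (fst y, x)) = \<rho> p * ?D y (0, b)" for b
        using E[OF Cinf_time_slice[OF f] p(1)] p(2) by simp
      then have "\<rho> p ^ 3 * X p (\<lambda>x. f (fst y, x)) = (\<Sum>b\<in>Basis. F b p * (\<rho> p * ?D y (0, b)))"
        using deriv[OF vector_fieldD[OF X]] by (simp add: F_def)
      then have "X p (\<lambda>x. f (fst y, x)) = (\<Sum>b\<in>Basis. F b p * (\<rho> p * ?D y (0, b))) * inverse (\<rho> p ^ 3)"
        using \<rho>p by (simp add: field_simps)
      then show ?thesis
        by (simp only: p_def sum_distrib_right power3_eq_cube)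
    qed
    ultimately have "Ck_on k T (\<lambda>y. X (?i (snd y)) (\<lambda>x. f (fst y, x)))"
      by (rule Ck_on_cong[OF T, rotated])
    moreover have "y0 \<in> T"
      using y0 \<rho>(2) by (simp add: T_def)
    ultimately show ?thesis
      using T by auto
  qed
qed

end

context exhausted_manifold
begin

lemma cov_time:
  assumes f: "f \<in> Cinf (time_atlas A)" and "set Xs \<subseteq> VF"
  shows "(\<lambda>y. cov (\<lambda>x. f (fst y, x)) Xs (snd y)) \<in> Cinf (time_atlas A)"
  using assms(2)
proof (induction Xs rule: measure_induct_rule[of length])
  case (less Xs)
  show ?case
  proof (cases Xs)
    case Nil
    then show ?thesis using f by simp
  next
    case (Cons X Ys)
    have X: "X \<in> VF" and Ys: "set Ys \<subseteq> VF"
      using less.prems Cons by auto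
    have IH: "(\<lambda>y. cov (\<lambda>x. f (fst y, x)) Ws (snd y)) \<in> Cinf (time_atlas A)"
      if "length Ws = length Ys" "set Ws \<subseteq> VF" for Ws
      using less.IH[of Ws] that Cons by simp
    have "(\<lambda>y. cov (\<lambda>x. f (fst y, x)) (Ys[l := conn X (Ys ! l)]) (snd y)) \<in> Cinf (time_atlas A)"
      if "l \<in> {..<length Ys}" for l
      using that by (intro IH set_update_conn_VF Ys X) auto
    then have "(\<lambda>y. \<Sum>l<length Ys. cov (\<lambda>x. f (fst y, x)) (Ys[l := conn X (Ys ! l)]) (snd y))
        \<in> Cinf (time_atlas A)"
      by (rule time.Cinf_sum)
    from time.Cinf_diff[OF Cinf_time_field[OF X IH[OF refl Ys]] this]
    show ?thesis
      unfolding Cons cov_deriv.simps by simp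
  qed
qed

lemma seminorm_tendsto:
  assumes f: "f \<in> Cinf (time_atlas A)"
  shows "((\<lambda>s. sn i j (\<lambda>x. f (s, x) - f (0, x))) \<longlongrightarrow> 0) (at 0)"
proof (rule compact_cov_bound[OF compact_K, of i j])
  fix \<E> C
  assume \<E>: "finite \<E>" "\<And>Es. Es \<in> \<E> \<Longrightarrow> set Es \<subseteq> VF" and C0: "C \<ge> 0"
    and C: "\<And>p h Xs M. p \<in> K i \<Longrightarrow> h \<in> Cinf A \<Longrightarrow> Xs \<in> unit_fields p j \<Longrightarrow> 0 \<le> M \<Longrightarrow>
      (\<And>Es. Es \<in> \<E> \<Longrightarrow> \<bar>cov h Es p\<bar> \<le> M) \<Longrightarrow> \<bar>cov h Xs p\<bar> \<le> C * M"
  have fs: "(\<lambda>x. f (s, x)) \<in> Cinf A" for s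
    by (rule Cinf_time_slice[OF f])
  note fd = Cinf_diff[OF fs fs]
  show ?thesis
  proof (rule tendstoI)
    fix e :: real assume e: "e > 0"
    \<comment> \<open>The summand 1 covers C = 0 and makes C * \<epsilon> < e strict.\<close>
    define \<epsilon> where "\<epsilon> = e / (C + 1)"
    have \<epsilon>: "\<epsilon> > 0" and C\<epsilon>: "C * \<epsilon> < e"
      using e C0 by (simp_all add: \<epsilon>_def field_simps)
    have "\<forall>\<^sub>F s in at 0. \<forall>p\<in>K i. \<bar>cov (\<lambda>x. f (s, x) - f (0, x)) Es p\<bar> \<le> \<epsilon>" if Es: "Es \<in> \<E>" for Es
    proof -
      let ?G = "\<lambda>y. cov (\<lambda>x. f (fst y, x)) Es (snd y)"
      have "continuous_on (UNIV \<times> K i) ?G"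
        by (rule continuous_on_subset[OF Cinf_time_continuous[OF cov_time[OF f \<E>(2)[OF Es]]]]) simp
      \<comment> \<open>Joint continuity and compactness of \<open>K i\<close> make the closeness to
        time 0 uniform in p.\<close>
      then obtain X0 where X0: "0 \<in> X0" "open X0"
        "\<forall>s\<in>X0 \<inter> UNIV. \<forall>p\<in>K i. dist (?G (s, p)) (?G (0, p)) \<le> \<epsilon>"
        by (rule continuous_on_prod_compactE[OF _ compact_K UNIV_I \<epsilon>])
      have "\<forall>\<^sub>F s in at 0. s \<in> X0"
        using X0(1,2) by (rule eventually_at_in_open'[rotated])
      then show ?thesis
      proof eventually_elim
        case (elim s)
        then show ?case
          using X0(3) \<E>(2)[OF Es] by (simp add: cov_diff fs dist_real_def)
      qed
    qed
    then have "\<forall>\<^sub>F s in at 0. \<forall>Es\<in>\<E>. \<forall>p\<in>K i. \<bar>cov (\<lambda>x. f (s, x) - f (0, x)) Es p\<bar> \<le> \<epsilon>"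
      by (intro eventually_ball_finite \<E>(1)) blast
    then show "\<forall>\<^sub>F s in at 0. dist (sn i j (\<lambda>x. f (s, x) - f (0, x))) 0 < e"
    proof eventually_elim
      case (elim s)
      have "sn i j (\<lambda>x. f (s, x) - f (0, x)) \<le> C * \<epsilon>"
        using C0 \<epsilon> elim by (intro seminorm_le C[OF _ fd]) auto
      then show ?case
        using C\<epsilon> seminorm_nonneg[OF fd, of i j s 0] by simp
    qed
  qed
qed

lemma limitin_time:
  assumes "f \<in> Cinf (time_atlas A)"
  shows "limitin \<T> (\<lambda>s x. f (s, x)) (\<lambda>x. f (0, x)) (at 0)"
  by (intro limitin_cinf seminorm_tendsto Cinf_time_slice assms)

end

section \<open>The Koopman group of a flow\<close>

locale generated_flow = exhausted_manifold A g conn V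
  for A :: "('a::{t2_space,second_countable_topology}, 'e::euclidean_space) atlas"
    and g :: "'a \<Rightarrow> 'a tvec \<Rightarrow> 'a tvec \<Rightarrow> real"
    and conn :: "'a vfield \<Rightarrow> 'a vfield \<Rightarrow> 'a vfield"
    and V :: "nat \<Rightarrow> 'a set" +
  fixes X :: "real \<Rightarrow> 'a vfield" and \<Phi> :: "real \<times> 'a \<Rightarrow> 'a"
  assumes field: "time_dependent_vector_field A X" and generates: "generates A X \<Phi>"
begin

abbreviation "U \<equiv> koopman A \<Phi>"
abbreviation "L \<equiv> \<lambda>t. lie_derivative A (X t)"

lemma flow_smooth: "smooth_map (time_atlas A) A \<Phi>"
  and flow_0 [simp]: "\<Phi> (0, x) = x"
  and flow_add: "\<Phi> (s + t, x) = \<Phi> (s, \<Phi> (t, x))"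
  using generates by (auto simp: generates_def global_flow_def)

lemma flow_inv: "\<Phi> (t, \<Phi> (- t, x)) = x" "\<Phi> (- t, \<Phi> (t, x)) = x"
  using flow_add[of t "- t" x] flow_add[of "- t" t x] by simp_all

lemma flow_commute: "\<Phi> (s, \<Phi> (t, x)) = \<Phi> (t, \<Phi> (s, x))"
  using flow_add[of s t x] flow_add[of t s x] by (simp add: add.commute)

lemma flow_derivative:
  "h \<in> Cinf A \<Longrightarrow> ((\<lambda>s. h (\<Phi> (s, x))) has_real_derivative X t (\<Phi> (t, x)) h) (at t)"
  using generates by (simp add: generates_def)

lemma pull_time: "h \<in> Cinf A \<Longrightarrow> (\<lambda>y. h (\<Phi> y)) \<in> Cinf (time_atlas A)"
  by (rule Cinf_time_flow[OF flow_smooth])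

lemma pull: "h \<in> Cinf A \<Longrightarrow> (\<lambda>x. h (\<Phi> (t, x))) \<in> Cinf A"
  using Cinf_time_slice[OF pull_time] by simp

lemma X_Cinf: "h \<in> Cinf A \<Longrightarrow> (\<lambda>p. X t p h) \<in> Cinf A"
  using field Cinf_time_slice[of "\<lambda>(t, p). X t p h" t] by (simp add: time_dependent_vector_field_def)

lemma koopman_apply: "h \<in> Cinf A \<Longrightarrow> U t h = (\<lambda>x. h (\<Phi> (t, x)))"
  by (simp add: koopman_def o_def)

lemma koopman_Cinf: "h \<in> Cinf A \<Longrightarrow> U t h \<in> Cinf A"
  by (simp add: koopman_apply pull)

lemma koopman_ext: "U t \<in> extensional (Cinf A)"
  by (simp add: koopman_def)

lemma koopman_0: "U 0 = (\<lambda>h\<in>Cinf A. h)"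
  by (auto simp: koopman_def o_def)

text \<open>Pullback reverses the order of composition; the order is restored because flow maps
  commute, addition of times being commutative.\<close>

lemma koopman_add: "U (s + t) = compose (Cinf A) (U s) (U t)"
proof (rule extensionalityI[OF koopman_ext compose_extensional])
  fix h assume h: "h \<in> Cinf A"
  then show "U (s + t) h = compose (Cinf A) (U s) (U t) h"
    by (simp add: compose_eq koopman_apply pull flow_add flow_commute)
qed

lemma continuous_map_koopman: "continuous_map \<T> \<T> (U t)"
proof (rule continuous_map_cinf)
  fix h k assume "h \<in> Cinf A" "k \<in> Cinf A"
  then show "U t (\<lambda>x. h x - k x) = (\<lambda>x. U t h x - U t k x)"
    by (simp add: koopman_apply Cinf_diff)
next
  fix i j
  have "continuous_on UNIV \<Phi>"
    using flow_smooth by (simp add: smooth_map_def)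
  then have "continuous_on UNIV (\<lambda>x. \<Phi> (t, x))"
    by (rule continuous_on_compose2) (auto intro!: continuous_intros)
  from pullback_seminorm_bound[OF pull pull flow_inv this, of i j]
  show "\<exists>C i' J. C \<ge> 0 \<and> (\<forall>h\<in>Cinf A. sn i j (U t h) \<le> C * (\<Sum>j'<J. sn i' j' h))"
    by (simp add: koopman_apply)
qed (rule koopman_Cinf)

lemma homeomorphic_map_koopman: "homeomorphic_map \<T> \<T> (U t)"
  unfolding homeomorphic_map_maps homeomorphic_maps_def
  by (intro exI[of _ "U (- t)"])
    (auto simp: continuous_map_koopman topspace_cinf koopman_apply pull flow_inv)

lemma koopman_hom: "U \<in> hom real_group (Aut (Cinf A) \<T>)"
proof (rule homI)
  fix t
  show "U t \<in> carrier (Aut (Cinf A) \<T>)"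
    by (auto simp: Aut_def koopman_ext homeomorphic_map_koopman koopman_apply Cinf_add Cinf_cmult)
next
  fix s t
  show "U (s \<otimes>\<^bsub>real_group\<^esub> t) = U s \<otimes>\<^bsub>Aut (Cinf A) \<T>\<^esub> U t"
    by (simp add: real_group_def Aut_def koopman_add)
qed

lemma koopman_strongly_continuous:
  assumes "h \<in> Cinf A"
  shows "limitin \<T> (\<lambda>t. U t h) h (at 0)"
  using limitin_time[OF pull_time[OF assms]] by (simp add: koopman_apply[OF assms])

text \<open>The group law forces the generating field to be autonomous.\<close>

lemma X_autonomous:
  assumes h: "h \<in> Cinf A"
  shows "X t p h = X 0 p h"
proof (rule DERIV_unique)
  \<comment> \<open>The trajectory from \<Phi> (- t, p) reaches p at time t with velocity given by
    \<open>X t\<close>. Shifted by t it is the trajectory from p, whose initial velocity is given by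
    \<open>X 0\<close>.\<close>
  have "((\<lambda>s. h (\<Phi> (s, \<Phi> (- t, p)))) has_real_derivative X t p h) (at (0 + t))"
    using flow_derivative[OF h, of "\<Phi> (- t, p)" t] by (simp add: flow_inv)
  then show "((\<lambda>s. h (\<Phi> (s, p))) has_real_derivative X t p h) (at 0)"
    unfolding DERIV_shift by (simp add: flow_add flow_inv)
  show "((\<lambda>s. h (\<Phi> (s, p))) has_real_derivative X 0 p h) (at 0)"
    using flow_derivative[OF h, of p 0] by simp
qed

text \<open>Both sides are the derivative at s = 0 of h along \<Phi> (t + s, p): once as h o
  \<Phi>_t along the trajectory of p at time 0, once as h along that trajectory at time t. The first
  gives \<open>X 0\<close>, which \<open>X_autonomous\<close> turns into \<open>X t\<close>.\<close>

lemma koopman_lie_commute: "compose (Cinf A) (L t) (U t) = compose (Cinf A) (U t) (L t)"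
proof (rule extensionalityI[OF compose_extensional compose_extensional])
  fix h assume h: "h \<in> Cinf A"
  have "X t p (\<lambda>x. h (\<Phi> (t, x))) = X t (\<Phi> (t, p)) h" for p
  proof (rule DERIV_unique)
    show "((\<lambda>s. h (\<Phi> (t, \<Phi> (s, p)))) has_real_derivative X t p (\<lambda>x. h (\<Phi> (t, x)))) (at 0)"
      using flow_derivative[OF pull[OF h], of t p 0] by (simp add: X_autonomous[OF pull[OF h], of t])
    have "((\<lambda>s. h (\<Phi> (s, p))) has_real_derivative X t (\<Phi> (t, p)) h) (at (0 + t))"
      using flow_derivative[OF h, of p t] by simp
    then show "((\<lambda>s. h (\<Phi> (t, \<Phi> (s, p)))) has_real_derivative X t (\<Phi> (t, p)) h) (at 0)"
      unfolding DERIV_shift by (simp add: flow_add flow_commute)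
  qed
  then show "compose (Cinf A) (L t) (U t) h = compose (Cinf A) (U t) (L t) h"
    using h by (simp add: compose_eq koopman_apply pull X_Cinf lie_derivative_def)
qed

text \<open>
  The difference quotient equals \<open>\<integral>\<^sub>0\<^sup>1 (L k)(\<Phi>(\<theta> s, x)) d\<theta>\<close>, which is jointly smooth in \<open>(s, x)\<close>, so
  that differentiability reduces to strong continuity.
\<close>

lemma flow_difference_quotient:
  assumes k: "k \<in> Cinf A" and s: "s \<noteq> 0"
  shows "integral {0..1} (\<lambda>\<theta>. X 0 (\<Phi> (\<theta> * s, x)) k) = (k (\<Phi> (s, x)) - k x) / s"
proof -
  have "((\<lambda>\<theta>. k (\<Phi> (\<theta> * s, x))) has_vector_derivative s * X 0 (\<Phi> (\<theta> * s, x)) k) (at \<theta> within {0..1})" for \<theta>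
  proof -
    have "((\<lambda>s. k (\<Phi> (s, x))) has_real_derivative X 0 (\<Phi> (\<theta> * s, x)) k) (at (\<theta> * s))"
      using flow_derivative[OF k, of x "\<theta> * s"]
      by (simp only: X_autonomous[OF k, of "\<theta> * s"])
    moreover have "((\<lambda>\<theta>. \<theta> * s) has_real_derivative s) (at \<theta>)"
      by (auto intro!: derivative_eq_intros)
    ultimately have "((\<lambda>\<theta>. k (\<Phi> (\<theta> * s, x))) has_real_derivative X 0 (\<Phi> (\<theta> * s, x)) k * s) (at \<theta>)"
      by (rule DERIV_chain2)
    then show ?thesis
      by (simp add: has_real_derivative_iff_has_vector_derivative has_vector_derivative_at_within mult.commute)
  qed
  then have "((\<lambda>\<theta>. s * X 0 (\<Phi> (\<theta> * s, x)) k) has_integral k (\<Phi> (1 * s, x)) - k (\<Phi> (0 * s, x))) {0..1}"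
    by (intro fundamental_theorem_of_calculus) auto
  from integral_unique[OF this]
  have "s * integral {0..1} (\<lambda>\<theta>. X 0 (\<Phi> (\<theta> * s, x)) k) = k (\<Phi> (s, x)) - k x"
    by simp
  then show ?thesis
    using s by (simp add: field_simps)
qed

lemma koopman_strong_derivative:
  "has_strong_derivative (Cinf A) \<T> U (compose (Cinf A) (L t) (U t)) t"
  unfolding has_strong_derivative_def
proof
  fix h assume h: "h \<in> Cinf A"
  \<comment> \<open>By the group law U (t + s) h is k o \<Phi>_s, so the derivative at t becomes one
    at 0. For s = 0 the integrand of \<open>q\<close> is constant in \<theta>, equal to X 0 x k, and
    this is the limit.\<close>
  define k where "k = U t h"
  have k: "k \<in> Cinf A" by (simp add: k_def koopman_Cinf h)
  define q where "q = (\<lambda>y. integral {0..1} (\<lambda>\<theta>. X 0 (\<Phi> (\<theta> * fst y, snd y)) k))"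
  have "q \<in> Cinf (time_atlas A)"
    unfolding q_def by (rule Cinf_time_average[OF pull_time[OF X_Cinf[OF k]]])
  then have "limitin \<T> (\<lambda>s x. q (s, x)) (\<lambda>x. q (0, x)) (at 0)"
    by (rule limitin_time)
  moreover have "(\<lambda>x. q (0, x)) = compose (Cinf A) (L t) (U t) h"
    using h k by (simp add: q_def compose_eq lie_derivative_def X_autonomous[OF k, of t] flip: k_def)
  moreover have "\<forall>\<^sub>F s in at 0. (\<lambda>x. q (s, x)) = (\<lambda>x. (U (t + s) h x - U t h x) / s)"
    unfolding eventually_at_filter
  proof (rule always_eventually, intro allI impI ext)
    fix s :: real and x assume "s \<noteq> 0"
    then show "q (s, x) = (U (t + s) h x - U t h x) / s"
      using flow_difference_quotient[OF k, of s x]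
      by (simp add: q_def k_def koopman_apply h flow_add)
  qed
  ultimately show "limitin \<T> (\<lambda>s x. (U (t + s) h x - U t h x) / s) (compose (Cinf A) (L t) (U t) h) (at 0)"
    using limitin_transform_eventually by fastforce
qed

end

theorem proposition2:
  fixes A :: "('a::{t2_space,second_countable_topology}, 'e::euclidean_space) atlas"
    and inputs :: "(real \<Rightarrow> real ^ 'm) set"
    and F :: "real \<Rightarrow> 'a \<Rightarrow> real ^ 'm \<Rightarrow> 'a tvec"
    and \<Phi> :: "(real \<Rightarrow> real ^ 'm) \<Rightarrow> real \<times> 'a \<Rightarrow> 'a"
    and g :: "'a \<Rightarrow> 'a tvec \<Rightarrow> 'a tvec \<Rightarrow> real"
    and conn :: "'a vfield \<Rightarrow> 'a vfield \<Rightarrow> 'a vfield"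
    and V :: "nat \<Rightarrow> 'a set"
  assumes "smooth_manifold A"
    and "riemannian_metric A g" and "affine_connection A conn" and "exhaustion V"
    and "\<And>u. u \<in> inputs \<Longrightarrow> time_dependent_vector_field A (\<lambda>t x. F t x (u t))"
    and "\<And>u. u \<in> inputs \<Longrightarrow> generates A (\<lambda>t x. F t x (u t)) (\<Phi> u)"
  defines "C \<equiv> Cinf A"
    and "\<T> \<equiv> cinf_topology A g conn V"
    and "U \<equiv> \<lambda>u. koopman A (\<Phi> u)"
    and "L \<equiv> \<lambda>u t. lie_derivative A (\<lambda>x. F t x (u t))"
  shows "\<forall>u\<in>inputs.
      (\<forall>t. continuous_map \<T> \<T> (U u t)) \<and>
      strongly_continuous_one_parameter_subgroup C \<T> (U u) \<and>
      (\<forall>t. has_strong_derivative C \<T> (U u) (compose C (L u t) (U u t)) t \<and>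
           compose C (L u t) (U u t) = compose C (U u t) (L u t)) \<and>
      U u 0 = \<one>\<^bsub>Aut C \<T>\<^esub>"
proof
  fix u assume u: "u \<in> inputs"
  \<comment> \<open>For a fixed input the control system is one time-dependent field with its own
    flow, which is the setting of the locale.\<close>
  interpret generated_flow A g conn V "\<lambda>t x. F t x (u t)" "\<Phi> u"
    using assms(1-4) assms(5,6)[OF u] by unfold_locales
  show "(\<forall>t. continuous_map \<T> \<T> (U u t)) \<and>
      strongly_continuous_one_parameter_subgroup C \<T> (U u) \<and>
      (\<forall>t. has_strong_derivative C \<T> (U u) (compose C (L u t) (U u t)) t \<and>
           compose C (L u t) (U u t) = compose C (U u t) (L u t)) \<and>
      U u 0 = \<one>\<^bsub>Aut C \<T>\<^esub>"
    unfolding C_def \<T>_def U_def L_def strongly_continuous_one_parameter_subgroup_def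
    using continuous_map_koopman koopman_hom koopman_strongly_continuous koopman_strong_derivative
      koopman_lie_commute koopman_0
    by (simp add: Aut_def)
qed

end
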